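(* Let $m\ge3$ and let $F_1=F_2=1$, $F_{k+1}=F_k+F_{k-1}$ be the Fibonacci sequence. For every $n\ge5$ with $F_1+\cdots+F_n\ge m-4$, the $m$-gonal form $F_1P_m(x_1)+F_2P_m(x_2)+\cdots+F_nP_m(x_n)$ is universal.
   Context: For $m\ge 3$ and $x\in\mathbb Z$, $P_m(x)=\frac{m-2}{2}x^2-\frac{m-4}{2}x$. A form $\sum_k a_kP_m(x_k)$ is universal if for every positive integer $N$ there is $\mathbf x\in\mathbb Z^n$ with $\sum_k a_kP_m(x_k)=N$. *)

theory Defs
  imports "HOL-Number_Theory.Fib"
begin

(* The numerator is always even (see double_polygonal), so the integer division is exact. *)
definition polygonal :: "int \<Rightarrow> int \<Rightarrow> int" where
  "polygonal m x = ((m - 2) * x\<^sup>2 - (m - 4) * x) div 2"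

lemma double_polygonal: "2 * polygonal m x = (m - 2) * x\<^sup>2 - (m - 4) * x"
proof -
  have "even ((m - 2) * x\<^sup>2 - (m - 4) * x)"
    by simp
  then show ?thesis
    unfolding polygonal_def by simp
qed

lemma of_int_polygonal:
  "(of_int (polygonal m x) :: 'a :: field_char_0) =
     (of_int m - 2) / 2 * (of_int x)\<^sup>2 - (of_int m - 4) / 2 * of_int x"
proof -
  have "2 * (of_int (polygonal m x) :: 'a) = of_int (2 * polygonal m x)"
    by simp
  also have "\<dots> = of_int ((m - 2) * x\<^sup>2 - (m - 4) * x)"
    by (simp only: double_polygonal)
  also have "\<dots> = 2 * ((of_int m - 2) / 2 * (of_int x)\<^sup>2 - (of_int m - 4) / 2 * of_int x)"
    by (simp add: right_diff_distrib)
  finally show ?thesis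
    using mult_left_cancel[of "2 :: 'a"] zero_neq_numeral by metis
qed

definition polygonal_form :: "int \<Rightarrow> nat \<Rightarrow> (nat \<Rightarrow> int) \<Rightarrow> (nat \<Rightarrow> int) \<Rightarrow> int" where
  "polygonal_form m n a x = (\<Sum>k = 1..n. a k * polygonal m (x k))"

(* Vectors in Z^n are functions on nat of which only the values at 1, ..., n matter. *)
definition universal_polygonal_form :: "int \<Rightarrow> nat \<Rightarrow> (nat \<Rightarrow> int) \<Rightarrow> bool" where
  "universal_polygonal_form m n a \<longleftrightarrow>
     (\<forall>N > 0. \<exists>x :: nat \<Rightarrow> int. polygonal_form m n a x = N)"

end

theory Submission
  imports Defs "HOL-Number_Theory.Number_Theory" "HOL-Computational_Algebra.Squarefree"
begin

text \<open>
  With \<open>M = m - 2\<close>, the form takes the value \<open>M A + B\<close> as soon as \<open>\<Sum> F\<^sub>k x\<^sub>k = B\<close> and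
  \<open>\<Sum> F\<^sub>k x\<^sub>k\<^sup>2 = 2 A + B\<close>, so for given \<open>A \<ge> 1\<close> one wants all \<open>B\<close> in an interval containing
  \<open>0, \<dots>, M - 1\<close>. Since \<open>x\<^sub>k \<in> {0, 1}\<close> adds \<open>F\<^sub>k\<close> to \<open>B\<close> without changing \<open>A\<close>, five or six variables decide.
  On the section \<open>x\<^sub>4 - x\<^sub>5 = \<plusminus>2\<close> of the five-variable system the problem becomes
  \<open>12 (2 A + B) - B\<^sup>2 - 90 = 2 z\<^sup>2 + 3 u\<^sup>2 + 6 t\<^sup>2\<close> with congruence conditions on \<open>z, u, t\<close>. They hold
  automatically for odd \<open>B\<close>; for even \<open>B\<close> they are enforced by arithmetic in \<open>\<int>[\<surd>-2]\<close>, except when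
  \<open>6\<close> divides \<open>B\<close>, where a suitable \<open>A\<close> modulo 3 is needed and is reached through
  \<open>(A, B) \<mapsto> (A \<mp> 1, B \<plusminus> M)\<close> or through the sixth variable. Representability by \<open>2 z\<^sup>2 + 3 u\<^sup>2 + 6 t\<^sup>2\<close>
  follows from the theorem on three squares for integers congruent to 1 or 2 modulo 4.

  For three squares, a prime \<open>q\<close> such that \<open>-q\<close> is a square modulo \<open>n\<close> and \<open>-n\<close> is a square modulo \<open>q\<close>
  yields a unimodular positive ternary form representing \<open>n\<close>, and such a form is equivalent to a sum
  of three squares. The prime has prescribed values of finitely many quadratic characters, so only
  the case of real characters of Dirichlet's theorem is needed; it is proved as by Mertens, with
  Monsky's argument for \<open>L(1, \<chi>) \<noteq> 0\<close>.
\<close>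

section \<open>Estimates of Chebyshev and Mertens\<close>

text \<open>Summation by parts: the boundary terms cost \<open>C * f (Suc N)\<close> and
  \<open>C * f (Suc M)\<close>, and the differences of the decreasing \<open>f\<close> telescope to
  at most \<open>C * (f (Suc M) - f (Suc N))\<close>.\<close>

lemma abel_sum_bound:
  fixes a f :: "nat \<Rightarrow> real"
  assumes bounded: "\<And>N. \<bar>\<Sum>n=1..N. a n\<bar> \<le> C"
    and mono: "\<And>n. n \<ge> 1 \<Longrightarrow> f (Suc n) \<le> f n"
    and nonneg: "\<And>n. n \<ge> 1 \<Longrightarrow> 0 \<le> f n"
    and "M \<le> N"
  shows "\<bar>\<Sum>n\<in>{M<..N}. a n * f n\<bar> \<le> 2 * C * f (Suc M)"
proof -
  define S where "S N = (\<Sum>n=1..N. a n)" for N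
  have S: "\<bar>S n\<bar> \<le> C" for n using bounded by (simp add: S_def)
  have C: "0 \<le> C" using S[of 0] by simp
  have "(\<Sum>n\<in>{M<..N}. a n * f n) =
          S N * f (Suc N) - S M * f (Suc M) + (\<Sum>n\<in>{M<..N}. S n * (f n - f (Suc n)))
      \<and> (\<Sum>n\<in>{M<..N}. f n - f (Suc n)) = f (Suc M) - f (Suc N)"
    using \<open>M \<le> N\<close>
  proof (induction N rule: dec_induct)
    case base
    show ?case by simp
  next
    case (step N)
    have "{M<..Suc N} = insert (Suc N) {M<..N}" using step(1) by auto
    moreover have "S (Suc N) = S N + a (Suc N)" by (simp add: S_def)
    ultimately show ?case using step(3) by (simp add: algebra_simps)
  qed
  note parts = this[THEN conjunct1] and tele = this[THEN conjunct2]
  have "\<bar>\<Sum>n\<in>{M<..N}. S n * (f n - f (Suc n))\<bar> \<le> (\<Sum>n\<in>{M<..N}. C * (f n - f (Suc n)))"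
    by (rule sum_abs[THEN order_trans])
       (intro sum_mono, use mono in \<open>auto simp: abs_mult intro!: mult_mono S C\<close>)
  also have "\<dots> = C * (f (Suc M) - f (Suc N))"
    by (simp only: sum_distrib_left[symmetric] tele)
  finally have 1: "\<bar>\<Sum>n\<in>{M<..N}. S n * (f n - f (Suc n))\<bar> \<le> C * (f (Suc M) - f (Suc N))" .
  have 2: "\<bar>S k * f (Suc k)\<bar> \<le> C * f (Suc k)" for k
    using nonneg[of "Suc k"] S[of k] by (simp add: abs_mult mult_right_mono)
  have "C * (f (Suc M) - f (Suc N)) = C * f (Suc M) - C * f (Suc N)" by (rule right_diff_distrib)
  then show ?thesis unfolding parts using 1 2[of N] 2[of M] by linarith
qed

text \<open>Both sides run over the pairs of positive integers with \<open>d * e \<le> N\<close>,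
  grouped by the product or by the first factor.\<close>

lemma sum_divisors_swap:
  fixes g :: "nat \<Rightarrow> nat \<Rightarrow> 'a :: comm_monoid_add"
  shows "(\<Sum>n=1..N. \<Sum>d | d dvd n. g d (n div d)) = (\<Sum>d=1..N. \<Sum>e=1..N div d. g d e)"
proof -
  have fin: "finite {d. d dvd n}" if "n \<in> {1..N}" for n :: nat
    using that by (intro finite_divisors_nat) auto
  have "(\<Sum>n=1..N. \<Sum>d | d dvd n. g d (n div d)) =
      (\<Sum>(n, d)\<in>(SIGMA n:{1..N}. {d. d dvd n}). g d (n div d))"
    by (subst sum.Sigma) (use fin in auto)
  also have "\<dots> = (\<Sum>(d, e)\<in>(SIGMA d:{1..N}. {1..N div d}). g d e)"
    by (rule sum.reindex_bij_witness[of _ "\<lambda>(d, e). (d * e, d)" "\<lambda>(n, d). (d, n div d)"])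
       (auto simp: Suc_le_eq div_greater_zero_iff less_eq_div_iff_mult_less_eq mult.commute
             div_le_mono intro: order_trans[OF dvd_imp_le] dvd_pos_nat dest: dvd_imp_le)
  also have "\<dots> = (\<Sum>d=1..N. \<Sum>e=1..N div d. g d e)"
    by (subst sum.Sigma) auto
  finally show ?thesis .
qed

lemma ln_Suc_diff_le: "n \<ge> 1 \<Longrightarrow> real n * (ln (real (Suc n)) - ln (real n)) \<le> 1"
proof -
  assume n: "n \<ge> 1"
  have "1 + 1 / real n = real (Suc n) / real n"
    using n by (simp add: field_simps)
  then have "ln (real (Suc n)) - ln (real n) = ln (1 + 1 / real n)"
    using n by (simp add: ln_div)
  also have "\<dots> \<le> 1 / real n" by (rule ln_add_one_self_le_self) simp
  finally show ?thesis using n by (simp add: field_simps)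
qed

lemma ln_fact_ge: "real N * ln (real N) - real N \<le> ln (fact N)"
proof (induction N)
  case (Suc N)
  show ?case
  proof (cases "N = 0")
    case False
    have "ln (fact (Suc N) :: real) = ln (real (Suc N)) + ln (fact N)"
      by (simp add: ln_mult del: of_nat_Suc)
    then show ?thesis using Suc ln_Suc_diff_le[of N] False by (simp add: algebra_simps)
  qed simp
qed simp

text \<open>Each \<open>ln n\<close> is the sum of \<open>mangoldt d\<close> over the divisors
  \<open>d\<close> of \<open>n\<close>, so \<open>d\<close> is counted once for each of its
  multiples up to \<open>N\<close>.\<close>

lemma ln_fact_mangoldt:
  "ln (fact N) = (\<Sum>d=1..N. mangoldt d * real (N div d))"
proof -
  have "ln (fact N) = (\<Sum>n=1..N. ln (real n))"
    unfolding fact_prod of_nat_prod by (rule ln_prod) auto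
  also have "\<dots> = (\<Sum>n=1..N. \<Sum>d | d dvd n. mangoldt d)"
    by (intro sum.cong refl) (subst mangoldt_sum, auto)
  also have "\<dots> = (\<Sum>d=1..N. \<Sum>e=1..N div d. mangoldt d)"
    by (rule sum_divisors_swap)
  finally show ?thesis by (simp add: mult.commute)
qed

text \<open>Lower half of Mertens' first theorem: in the formula for \<open>ln (fact N)\<close>,
  replacing \<open>N div d\<close> by the real quotient only increases the sum.\<close>

lemma sum_mangoldt_over_ge:
  assumes "N \<ge> 1"
  shows "ln (real N) - 1 \<le> (\<Sum>d=1..N. mangoldt d / real d)"
proof -
  have "real N * ln (real N) - real N \<le> (\<Sum>d=1..N. mangoldt d * real (N div d))"
    using ln_fact_ge[of N] by (simp add: ln_fact_mangoldt)
  also have "\<dots> \<le> (\<Sum>d=1..N. mangoldt d * (real N / real d))"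
    by (intro sum_mono mult_left_mono of_nat_div_le_of_nat mangoldt_nonneg)
  also have "\<dots> = real N * (\<Sum>d=1..N. mangoldt d / real d)"
    by (simp add: sum_distrib_left mult.commute)
  finally have "real N * (ln (real N) - 1) \<le> real N * (\<Sum>d=1..N. mangoldt d / real d)"
    by (simp add: algebra_simps)
  then show ?thesis using assms by (simp add: mult_le_cancel_left)
qed

text \<open>Chebyshev's argument: the logarithm of the central binomial coefficient is the Mangoldt
  sum with weights \<open>2 * n div d - 2 * (n div d)\<close>. These are nonnegative, and at least 1
  for \<open>n < d \<le> 2 * n\<close>, while the coefficient is at most
  \<open>4 ^ n\<close>.\<close>

lemma sum_mangoldt_double:
  "(\<Sum>d\<in>{n<..2*n}. mangoldt d) \<le> 2 * real n * ln 2"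
proof -
  have "(\<Sum>d\<in>{n<..2*n}. mangoldt d :: real)
      \<le> (\<Sum>d=1..2*n. mangoldt d * (real (2 * n div d) - 2 * real (n div d)))"
  proof (rule order_trans[OF _ sum_mono2])
    show "(\<Sum>d\<in>{n<..2*n}. mangoldt d :: real)
        \<le> (\<Sum>d\<in>{n<..2*n}. mangoldt d * (real (2 * n div d) - 2 * real (n div d)))"
    proof (intro sum_mono)
      fix d assume d: "d \<in> {n<..2*n}"
      then have "2 * n div d \<ge> 1" by (simp add: div_greater_zero_iff Suc_le_eq)
      moreover have "n div d = 0" using d by auto
      ultimately show "(mangoldt d :: real) \<le> mangoldt d * (real (2 * n div d) - 2 * real (n div d))"
        using mult_left_mono[of 1 "real (2 * n div d)" "mangoldt d"] by (simp add: mangoldt_nonneg)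
    qed
  next
    fix d :: nat
    have "2 * (n div d) \<le> 2 * n div d"
      using div_add1_eq[of n n d] by (simp add: mult_2)
    then have "2 * real (n div d) \<le> real (2 * n div d)" by linarith
    then show "0 \<le> mangoldt d * (real (2 * n div d) - 2 * real (n div d))"
      by (simp add: mangoldt_nonneg)
  qed auto
  also have "\<dots> = (\<Sum>d=1..2*n. mangoldt d * real (2 * n div d)) - 2 * (\<Sum>d=1..2*n. mangoldt d * real (n div d))"
    by (simp add: sum_subtractf sum_distrib_left right_diff_distrib mult.left_commute)
  also have "(\<Sum>d=1..2*n. mangoldt d * real (n div d)) = (\<Sum>d=1..n. mangoldt d * real (n div d))"
    by (intro sum.mono_neutral_right) auto
  also have "(\<Sum>d=1..2*n. mangoldt d * real (2 * n div d)) - 2 * (\<Sum>d=1..n. mangoldt d * real (n div d))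
      = ln (fact (2 * n)) - 2 * ln (fact n)"
    by (simp only: ln_fact_mangoldt)
  also have "\<dots> = ln (real (2 * n choose n))"
  proof -
    have "real (2 * n choose n) = fact (2 * n) / (fact n * fact n)"
      using binomial_fact[of n "2 * n", where ?'a = real] by (simp add: mult_2)
    then show ?thesis by (simp add: ln_div ln_mult)
  qed
  also have "\<dots> \<le> ln (2 ^ (2 * n))"
  proof (subst ln_le_cancel_iff)
    have "real (2 * n choose n) \<le> real (2 ^ (2 * n))"
      by (intro of_nat_mono binomial_le_pow2)
    then show "real (2 * n choose n) \<le> 2 ^ (2 * n)" by simp
  qed auto
  finally show ?thesis by (simp add: ln_realpow)
qed

text \<open>Repeated halving. The constant 6 absorbs the rounding: for \<open>N \<ge> 2\<close> and
  \<open>2 * m \<le> N + 1\<close>, \<open>8 * m \<le> 4 * N + 4 \<le> 6 * N\<close>.\<close>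

lemma sum_mangoldt_le: "(\<Sum>d=1..N. mangoldt d) \<le> 6 * real N"
proof (induction N rule: less_induct)
  case (less N)
  show ?case
  proof (cases "N \<le> 1")
    case True
    then show ?thesis by (cases N) auto
  next
    case False
    define m where "m = (N + 1) div 2"
    have m: "m < N" "N \<le> 2 * m" "2 * real m \<le> real N + 1" using False by (auto simp: m_def)
    have "(\<Sum>d=1..N. mangoldt d :: real) \<le> (\<Sum>d=1..2*m. mangoldt d)"
      using m by (intro sum_mono2) (auto simp: mangoldt_nonneg)
    also have "{1..2*m} = {1..m} \<union> {m<..2*m}" by auto
    also have "(\<Sum>d\<in>{1..m} \<union> {m<..2*m}. mangoldt d :: real) = (\<Sum>d=1..m. mangoldt d) + (\<Sum>d\<in>{m<..2*m}. mangoldt d)"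
      by (rule sum.union_disjoint) auto
    also have "\<dots> \<le> 6 * real m + 2 * real m * 1"
      using less[OF m(1)] sum_mangoldt_double[of m] mult_left_mono[of "ln 2" 1 "2 * real m"] ln_2_less_1
      by linarith
    also have "\<dots> \<le> 6 * real N" using m(3) False by linarith
    finally show ?thesis .
  qed
qed

text \<open>The terms are dominated by the differences of \<open>(2 + ln N) / N\<close>, whose value
  at 1 is the bound. The summand 2 in that numerator pays for
  \<open>(z + 1) * (y - x) \<le> 2\<close>.\<close>

lemma sum_ln_over_le: "(\<Sum>p=2..N. ln (real p) / (real p * (real p - 1))) \<le> 2"
proof -
  have diff: "ln (real (Suc N)) / (real (Suc N) * real N)
       \<le> (2 + ln (real N)) / real N - (2 + ln (real (Suc N))) / real (Suc N)" if N: "N \<ge> 1" for N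
  proof -
    define x y z where "x = ln (real N)" and "y = ln (real (Suc N))" and "z = real N"
    have z: "z \<ge> 1" using N by (simp add: z_def)
    have zd: "z * (y - x) \<le> 1" using ln_Suc_diff_le[OF N] by (simp add: x_def y_def z_def)
    have "x \<le> y" using N by (simp add: x_def y_def)
    then have "1 * (y - x) \<le> z * (y - x)" using z by (intro mult_right_mono) auto
    then have "(z + 1) * (y - x) \<le> 2" using zd unfolding distrib_right by linarith
    moreover have "(2 + x) / z - (2 + y) / (z + 1) = ((2 + x) * (z + 1) - (2 + y) * z) / ((z + 1) * z)"
      using z by (simp add: diff_frac_eq mult.commute)
    moreover have "(2 + x) * (z + 1) - (2 + y) * z = 2 + y - (z + 1) * (y - x)"
      by (simp add: algebra_simps)
    ultimately have "y / ((z + 1) * z) \<le> (2 + x) / z - (2 + y) / (z + 1)"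
      using z by (simp add: divide_right_mono)
    then show ?thesis by (simp add: x_def y_def z_def add.commute)
  qed
  have "(\<Sum>p=2..N. ln (real p) / (real p * (real p - 1))) \<le> 2 - (2 + ln (real N)) / real N"
    if "N \<ge> 1"
    using that
  proof (induction N rule: dec_induct)
    case (step N)
    have "{2..Suc N} = insert (Suc N) {2..N}" using step(1) by auto
    then have "(\<Sum>p=2..Suc N. ln (real p) / (real p * (real p - 1))) =
        ln (real (Suc N)) / (real (Suc N) * real N) + (\<Sum>p=2..N. ln (real p) / (real p * (real p - 1)))"
      by simp
    then show ?case using step(3) diff[OF step(1)] by linarith
  qed simp
  note bound = this
  show ?thesis
  proof (cases "N \<ge> 1")
    case True
    then have "0 \<le> (2 + ln (real N)) / real N" by simp
    with bound[OF True] show ?thesis by linarith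
  qed (simp add: not_le)
qed

text \<open>Only proper prime powers contribute. \<open>h\<close> sends \<open>p ^ (k + 2)\<close>
  to \<open>(p, k)\<close>, and the geometric series over \<open>k\<close> sums to at most
  \<open>ln p / (p * (p - 1))\<close>.\<close>

lemma sum_mangoldt_not_prime_le:
  "(\<Sum>n | n \<in> {1..N} \<and> \<not> prime n. mangoldt n / real n) \<le> 2"
proof -
  define D where "D = {n \<in> {1..N}. \<not> prime n \<and> primepow n}"
  define h where "h n = (aprimedivisor n, multiplicity (aprimedivisor n) n - 2)" for n :: nat
  define w where "w = (\<lambda>(p, k). ln (real p) / real p ^ (k + 2))"
  have D: "prime (fst (h n)) \<and> fst (h n) ^ (snd (h n) + 2) = n \<and> h n \<in> {2..N} \<times> {..<N}"
    if "n \<in> D" for n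
  proof -
    from that obtain p j where pj: "prime p" "j > 0" "n = p ^ j" "\<not> prime n" "n \<le> N"
      by (auto simp: D_def primepow_def)
    then have "j \<noteq> 1" by auto
    then have "j \<ge> 2" using pj(2) by linarith
    then obtain k where k: "j = k + 2" using le_Suc_ex[of 2 j] by (auto simp: add.commute)
    have "h n = (p, k)"
      using pj by (simp add: h_def aprimedivisor_prime_power k del: power_Suc power_add_numeral)
    moreover have "p \<le> p ^ j" using pj by (intro self_le_power) (auto simp: prime_ge_Suc_0_nat)
    moreover have "j < p ^ j" using pj(1) by (intro power_gt_expt) (simp add: prime_gt_Suc_0_nat)
    ultimately show ?thesis using pj(1,3,5) k prime_ge_2_nat[OF pj(1)] by (simp del: power_Suc power_add_numeral)
  qed
  have inj: "inj_on h D"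
    by (rule inj_on_inverseI[of _ "\<lambda>(p, k). p ^ (k + 2)"]) (use D in \<open>simp add: case_prod_beta\<close>)
  have "(\<Sum>n | n \<in> {1..N} \<and> \<not> prime n. mangoldt n / real n) = (\<Sum>n\<in>D. mangoldt n / real n)"
    by (rule sum.mono_neutral_right) (auto simp: D_def mangoldt_def)
  also have "\<dots> = (\<Sum>n\<in>D. w (h n))"
  proof (intro sum.cong refl)
    fix n assume "n \<in> D"
    obtain p k where h: "h n = (p, k)" by force
    with D[OF \<open>n \<in> D\<close>] have p: "prime p" "p ^ (k + 2) = n" by simp_all
    show "mangoldt n / real n = w (h n)"
      unfolding h unfolding p(2)[symmetric] using p(1)
      by (simp add: w_def mangoldt_primepow del: power_Suc power_add_numeral)
  qed
  also have "\<dots> = sum w (h ` D)"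
    by (simp add: sum.reindex[OF inj])
  also have "\<dots> \<le> sum w ({2..N} \<times> {..<N})"
  proof (rule sum_mono2)
    show "h ` D \<subseteq> {2..N} \<times> {..<N}" using D by blast
  qed (auto simp: w_def)
  also have "\<dots> = (\<Sum>p=2..N. \<Sum>k<N. w (p, k))"
    by (subst sum.cartesian_product) (simp add: case_prod_beta)
  also have "\<dots> \<le> (\<Sum>p=2..N. ln (real p) / (real p * (real p - 1)))"
  proof (rule sum_mono)
    fix p assume p: "p \<in> {2..N}"
    define r where "r = real p"
    have r: "r \<ge> 2" using p by (simp add: r_def)
    have ln: "0 \<le> ln r / r\<^sup>2" using r by simp
    have "(\<Sum>k<N. (1 / r) ^ k) = (1 - (1 / r) ^ N) / (1 - 1 / r)"
      using r by (subst sum_gp_strict) auto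
    also have "\<dots> \<le> 1 / (1 - 1 / r)"
      using r by (intro divide_right_mono) auto
    also have "\<dots> = r / (r - 1)"
      using r by (simp add: divide_simps)
    finally have "ln r / r\<^sup>2 * (\<Sum>k<N. (1 / r) ^ k) \<le> ln r / r\<^sup>2 * (r / (r - 1))"
      using ln by (rule mult_left_mono)
    also have "\<dots> = ln r / (r * (r - 1))"
      using r by (simp add: power2_eq_square)
    finally show "(\<Sum>k<N. w (p, k)) \<le> ln (real p) / (real p * (real p - 1))"
      unfolding sum_distrib_left by (simp add: w_def r_def power_divide power2_eq_square mult.assoc)
  qed
  also have "\<dots> \<le> 2" by (rule sum_ln_over_le)
  finally show ?thesis .
qed

section \<open>Real characters and primes\<close>

text \<open>The inequality behind the monotonicity of Monsky's weights. With \<open>G k\<close> the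
  geometric sum, the induction uses \<open>G (n+1) * G (n+2) = t * G n * G (n+1) + G (n+1) * (1 + t
  ^ (n+1))\<close>.\<close>

lemma geometric_pair_bound:
  fixes t :: real
  assumes t: "0 \<le> t" "t \<le> 1"
  shows "real n * real (Suc n) * t ^ n \<le> (\<Sum>i<n. t ^ i) * (\<Sum>i<Suc n. t ^ i)"
proof (induction n)
  case (Suc n)
  define G where "G k = (\<Sum>i<k. t ^ i)" for k
  have G_nonneg: "0 \<le> G k" for k using t by (simp add: G_def sum_nonneg)
  \<comment> \<open>AM-GM for the exponents \<open>i\<close> and \<open>2 * (n + 1) - i\<close>.
    Lowering the second by one is allowed since \<open>t \<le> 1\<close>, and makes these exponents
    run through \<open>n + 1\<close> to \<open>2 * n + 1\<close>.\<close>
  have "2 * t ^ Suc n \<le> t ^ i + t ^ (Suc n + (n - i))" if "i < Suc n" for i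
  proof -
    define u where "u = t ^ (Suc n - i)"
    have e1: "t ^ Suc n = t ^ i * u" using that by (simp add: u_def flip: power_add)
    have e2: "t ^ i * u * u = t ^ (Suc n + (Suc n - i))"
      using that by (simp add: u_def flip: power_add)
    have "t ^ (Suc n + (Suc n - i)) \<le> t ^ (Suc n + (n - i))"
      using t by (intro power_decreasing) auto
    moreover have "0 \<le> t ^ i * (1 - u)\<^sup>2" using t by simp
    moreover have "t ^ i * (1 - u)\<^sup>2 = t ^ i + t ^ i * u * u - 2 * (t ^ i * u)"
      by (simp add: power2_eq_square algebra_simps)
    ultimately show ?thesis unfolding e1 using e2 by linarith
  qed
  then have "(\<Sum>i<Suc n. 2 * t ^ Suc n) \<le> (\<Sum>i<Suc n. t ^ i + t ^ (Suc n + (n - i)))"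
    by (intro sum_mono) auto
  also have "\<dots> = G (Suc n) + (\<Sum>i<Suc n. t ^ (Suc n + (Suc n - Suc i)))"
    by (simp add: sum.distrib G_def)
  also have "(\<Sum>i<Suc n. t ^ (Suc n + (Suc n - Suc i))) = (\<Sum>i<Suc n. t ^ (Suc n + i))"
    by (rule sum.nat_diff_reindex)
  also have "\<dots> = t ^ Suc n * G (Suc n)"
    by (simp only: power_add sum_distrib_left G_def)
  finally have 1: "2 * real (Suc n) * t ^ Suc n \<le> G (Suc n) * (1 + t ^ Suc n)"
    by (simp add: algebra_simps)
  have "G (Suc k) = 1 + t * G k" for k
    unfolding G_def sum.lessThan_Suc_shift by (simp add: sum_distrib_left)
  then have "G (Suc (Suc n)) = 1 + t * G n + t ^ Suc n"
    by (simp add: G_def algebra_simps)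
  then have "G (Suc n) * G (Suc (Suc n)) = t * (G n * G (Suc n)) + G (Suc n) * (1 + t ^ Suc n)"
    by (simp add: algebra_simps)
  moreover have "t * (real n * real (Suc n) * t ^ n) \<le> t * (G n * G (Suc n))"
    using Suc t by (intro mult_left_mono) (auto simp: G_def)
  moreover have "real (Suc n) * real (Suc (Suc n)) * t ^ Suc n =
      t * (real n * real (Suc n) * t ^ n) + 2 * real (Suc n) * t ^ Suc n"
    by (simp add: algebra_simps)
  ultimately show ?case using 1 unfolding G_def by linarith
qed simp

text \<open>\<open>b\<close> compares the weights of \<open>L(1, \<chi>) / (1 - t)\<close> with
  those of the Lambert series. After taking out \<open>1 / (1 - t)\<close>, its first part drops by
  \<open>1 / (n * (n + 1))\<close> and its second by \<open>t ^ n / (G n * G (n + 1))\<close>, which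
  is no larger.\<close>

lemma monsky_weights:
  fixes t :: real
  assumes t: "0 < t" "t < 1" and n: "n \<ge> 1"
  defines "b \<equiv> \<lambda>n. 1 / (real n * (1 - t)) - t ^ n / (1 - t ^ n)"
  shows "b (Suc n) \<le> b n" and "0 \<le> b n"
proof -
  define G where "G k = (\<Sum>i<k. t ^ i)" for k
  have G: "1 - t ^ k = (1 - t) * G k" for k
    unfolding G_def by (rule one_diff_power_eq)
  have Gpos: "0 < G k" if "k \<ge> 1" for k
  proof -
    have "0 < 1 - t ^ k" using t that by (simp add: power_less_one_iff)
    then show ?thesis using t by (simp add: G zero_less_mult_iff)
  qed
  have t1: "0 < 1 - t" using t by simp
  have Gn: "0 < G n" "0 < G (Suc n)" using Gpos n by auto
  have e: "b k = (1 / real k - t ^ k / G k) / (1 - t)" for k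
    unfolding b_def G by (simp add: diff_divide_distrib mult.commute)
  have "(\<Sum>i<n. t ^ n) \<le> G n"
    unfolding G_def using t by (intro sum_mono power_decreasing) auto
  then have "real n * t ^ n \<le> G n" by simp
  then have "t ^ n / G n \<le> 1 / real n" using Gn n by (simp add: divide_simps mult.commute)
  then show "0 \<le> b n" unfolding e using t1 by simp
  have "real n * real (Suc n) * t ^ n \<le> G n * G (Suc n)"
    unfolding G_def using t by (intro geometric_pair_bound) auto
  then have "t ^ n / (G n * G (Suc n)) \<le> 1 / (real n * real (Suc n))"
    using Gn n by (simp add: divide_simps mult_ac)
  also have "\<dots> = 1 / real n - 1 / real (Suc n)"
    using n by (simp add: divide_simps)
  finally have 1: "t ^ n / (G n * G (Suc n)) \<le> 1 / real n - 1 / real (Suc n)" .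
  have "G (Suc n) - t * G n = 1"
    unfolding G_def sum.lessThan_Suc_shift by (simp add: sum_distrib_left)
  moreover have "t ^ n * G (Suc n) - t ^ Suc n * G n = t ^ n * (G (Suc n) - t * G n)"
    by (simp add: algebra_simps)
  ultimately have "t ^ n * G (Suc n) - t ^ Suc n * G n = t ^ n" by simp
  moreover have "t ^ n / G n - t ^ Suc n / G (Suc n) = (t ^ n * G (Suc n) - t ^ Suc n * G n) / (G n * G (Suc n))"
    using Gn by (simp add: diff_frac_eq)
  ultimately have "t ^ n / G n - t ^ Suc n / G (Suc n) = t ^ n / (G n * G (Suc n))" by (simp only:)
  then have "1 / real (Suc n) - t ^ Suc n / G (Suc n) \<le> 1 / real n - t ^ n / G n"
    using 1 by linarith
  then show "b (Suc n) \<le> b n" unfolding e using t1 by (intro divide_right_mono) auto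
qed

text \<open>Bounded partial sums rule out a principal character and are what Abel summation needs;
  the parameter \<open>C\<close> keeps all later bounds explicit.\<close>

locale real_character =
  fixes \<chi> :: "nat \<Rightarrow> real" and C :: real
  assumes mult: "\<chi> (a * b) = \<chi> a * \<chi> b"
    and one: "\<chi> (Suc 0) = 1"
    and range: "\<chi> n \<in> {-1, 0, 1}"
    and bounded: "\<bar>\<Sum>n=1..N. \<chi> n\<bar> \<le> C"
begin

lemma C_nonneg: "0 \<le> C"
  using bounded[of 0] by simp

lemma abs_le_1: "\<bar>\<chi> n\<bar> \<le> 1"
  using range[of n] by auto

lemma power: "\<chi> (a ^ k) = \<chi> a ^ k"
  by (induction k) (auto simp: one mult)

section \<open>The value L(1, chi) and Mangoldt sums twisted by chi\<close>

definition partial_sum :: "nat \<Rightarrow> real" where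
  "partial_sum N = (\<Sum>n=1..N. \<chi> n / real n)"

definition L :: real where
  "L = lim partial_sum"

lemma partial_sum_diff: "M \<le> N \<Longrightarrow> \<bar>partial_sum N - partial_sum M\<bar> \<le> 2 * C / real (Suc M)"
proof -
  assume "M \<le> N"
  then have split: "{1..N} = {1..M} \<union> {M<..N}" by auto
  have "partial_sum N = partial_sum M + (\<Sum>n\<in>{M<..N}. \<chi> n * (1 / real n))"
    unfolding partial_sum_def split by (subst sum.union_disjoint) auto
  moreover have "\<bar>\<Sum>n\<in>{M<..N}. \<chi> n * (1 / real n)\<bar> \<le> 2 * C * (1 / real (Suc M))"
    using \<open>M \<le> N\<close> by (intro abel_sum_bound bounded) (auto simp: divide_simps)
  ultimately show ?thesis by simp
qed

lemma partial_sum_tendsto: "partial_sum \<longlonglongrightarrow> L"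
proof -
  have "Cauchy partial_sum"
  proof (rule CauchyI)
    fix e :: real assume "0 < e"
    obtain M :: nat where M: "4 * C / e < real M" using reals_Archimedean2 by blast
    have e: "4 * C < e * real (Suc M)"
      using M \<open>0 < e\<close> by (simp add: divide_less_eq algebra_simps)
    have "norm (partial_sum m - partial_sum n) < e" if "m \<ge> M" "n \<ge> M" for m n
    proof -
      have "\<bar>partial_sum m - partial_sum n\<bar> \<le> 2 * C / real (Suc M) + 2 * C / real (Suc M)"
        using partial_sum_diff[OF that(1)] partial_sum_diff[OF that(2)] by linarith
      also have "\<dots> = 4 * C / real (Suc M)" by (simp add: add_divide_distrib[symmetric])
      also have "\<dots> < e" using e by (subst divide_less_eq) auto
      finally show ?thesis by simp
    qed
    then show "\<exists>M. \<forall>m\<ge>M. \<forall>n\<ge>M. norm (partial_sum m - partial_sum n) < e" by blast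
  qed
  then show ?thesis
    unfolding L_def using Cauchy_convergent_iff convergent_LIMSEQ_iff by blast
qed

lemma L_approx: "\<bar>L - partial_sum M\<bar> \<le> 2 * C / real (Suc M)"
proof (rule LIMSEQ_le_const2)
  show "(\<lambda>N. \<bar>partial_sum N - partial_sum M\<bar>) \<longlonglongrightarrow> \<bar>L - partial_sum M\<bar>"
    by (intro tendsto_intros partial_sum_tendsto)
  show "\<exists>N. \<forall>n\<ge>N. \<bar>partial_sum n - partial_sum M\<bar> \<le> 2 * C / real (Suc M)"
    using partial_sum_diff by blast
qed

text \<open>\<open>ln n / n\<close> still increases for small \<open>n\<close>, whereas
  \<open>(1 + ln n) / n\<close> decreases from 1 on. Abel summation is applied to the latter and
  \<open>partial_sum N\<close> is subtracted, at a cost of \<open>2 * C\<close> each.\<close>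

lemma log_sum_bound: "\<bar>\<Sum>n=1..N. \<chi> n * (ln (real n) / real n)\<bar> \<le> 4 * C"
proof -
  have "\<bar>\<Sum>n\<in>{0<..N}. \<chi> n * ((1 + ln (real n)) / real n)\<bar> \<le> 2 * C * ((1 + ln (real (Suc 0))) / real (Suc 0))"
  proof (rule abel_sum_bound[OF bounded])
    fix n :: nat assume n: "n \<ge> 1"
    have "0 \<le> ln (real n)" using n by simp
    then have "real n * (1 + ln (real (Suc n))) \<le> real (Suc n) * (1 + ln (real n))"
      using ln_Suc_diff_le[OF n] by (simp add: algebra_simps)
    then show "(1 + ln (real (Suc n))) / real (Suc n) \<le> (1 + ln (real n)) / real n"
      using n by (simp add: divide_simps mult.commute del: of_nat_Suc)
  qed auto
  moreover have "(\<Sum>n\<in>{0<..N}. \<chi> n * ((1 + ln (real n)) / real n))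
      = partial_sum N + (\<Sum>n=1..N. \<chi> n * (ln (real n) / real n))"
    unfolding partial_sum_def sum.distrib[symmetric]
    by (intro sum.cong) (auto simp: add_divide_distrib distrib_left)
  moreover have "\<bar>partial_sum N\<bar> \<le> 2 * C"
    using partial_sum_diff[of 0 N] by (simp add: partial_sum_def)
  ultimately show ?thesis by simp
qed

text \<open>The logarithm is the Dirichlet convolution of \<open>mangoldt\<close> with 1, and the
  completely multiplicative \<open>\<chi>\<close> respects convolutions.\<close>

lemma log_sum_eq:
  "(\<Sum>n=1..N. \<chi> n * (ln (real n) / real n)) =
   (\<Sum>d=1..N. \<chi> d * mangoldt d / real d * partial_sum (N div d))"
proof -
  have "(\<Sum>n=1..N. \<chi> n * (ln (real n) / real n)) =
      (\<Sum>n=1..N. \<Sum>d | d dvd n. \<chi> d * mangoldt d / real d * (\<chi> (n div d) / real (n div d)))"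
  proof (intro sum.cong refl)
    fix n assume n: "n \<in> {1..N}"
    have "(\<Sum>d | d dvd n. \<chi> d * mangoldt d / real d * (\<chi> (n div d) / real (n div d))) =
        (\<Sum>d | d dvd n. \<chi> n / real n * mangoldt d)"
    proof (intro sum.cong refl)
      fix d assume "d \<in> {d. d dvd n}"
      then obtain e where e: "n = d * e" by blast
      then have "d > 0" using n by (auto intro: Nat.gr0I)
      then show "\<chi> d * mangoldt d / real d * (\<chi> (n div d) / real (n div d)) = \<chi> n / real n * mangoldt d"
        by (simp add: e mult)
    qed
    also have "\<dots> = \<chi> n * (ln (real n) / real n)"
      unfolding sum_distrib_left[symmetric] using mangoldt_sum[of n, where ?'a = real] n by simp
    finally show "\<chi> n * (ln (real n) / real n) =
        (\<Sum>d | d dvd n. \<chi> d * mangoldt d / real d * (\<chi> (n div d) / real (n div d)))" ..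
  qed
  also have "\<dots> = (\<Sum>d=1..N. \<Sum>e=1..N div d. \<chi> d * mangoldt d / real d * (\<chi> e / real e))"
    by (rule sum_divisors_swap)
  finally show ?thesis by (simp add: partial_sum_def sum_distrib_left)
qed

text \<open>Replacing \<open>partial_sum (N div d)\<close> by \<open>L\<close> in
  \<open>log_sum_eq\<close> costs at most \<open>2 * C / N * mangoldt d\<close> per term, hence
  \<open>12 * C\<close> by Chebyshev's bound; \<open>log_sum_bound\<close> adds
  \<open>4 * C\<close>.\<close>

lemma mangoldt_sum_bound:
  "\<bar>L * (\<Sum>d=1..N. \<chi> d * mangoldt d / real d)\<bar> \<le> 16 * C"
proof (cases "N = 0")
  case False
  have "\<bar>\<Sum>d=1..N. \<chi> d * mangoldt d / real d * (L - partial_sum (N div d))\<bar>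
      \<le> (\<Sum>d=1..N. 2 * C / real N * mangoldt d)"
  proof (rule sum_abs[THEN order_trans], rule sum_mono)
    fix d assume d: "d \<in> {1..N}"
    have "real N \<le> real d * real (Suc (N div d))"
    proof -
      have "N \<le> d * Suc (N div d)"
        using d dividend_less_times_div[of d N] by simp
      then show ?thesis by (metis of_nat_le_iff of_nat_mult)
    qed
    then have 1: "2 * C / (real d * real (Suc (N div d))) \<le> 2 * C / real N"
      using False d C_nonneg by (intro divide_left_mono) auto
    have "\<bar>\<chi> d * mangoldt d / real d * (L - partial_sum (N div d))\<bar> =
        \<bar>\<chi> d\<bar> * (mangoldt d / real d * \<bar>L - partial_sum (N div d)\<bar>)"
      by (simp add: abs_mult mangoldt_nonneg)
    also have "\<dots> \<le> 1 * (mangoldt d / real d * (2 * C / real (Suc (N div d))))"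
      by (intro mult_mono abs_le_1 L_approx order_refl) (auto simp: mangoldt_nonneg)
    also have "\<dots> = 2 * C / (real d * real (Suc (N div d))) * mangoldt d"
      by simp
    also have "\<dots> \<le> 2 * C / real N * mangoldt d"
      using 1 by (rule mult_right_mono) (simp add: mangoldt_nonneg)
    finally show "\<bar>\<chi> d * mangoldt d / real d * (L - partial_sum (N div d))\<bar>
        \<le> 2 * C / real N * mangoldt d" .
  qed
  also have "\<dots> = 2 * C / real N * (\<Sum>d=1..N. mangoldt d)"
    by (rule sum_distrib_left[symmetric])
  also have "\<dots> \<le> 2 * C / real N * (6 * real N)"
    using C_nonneg by (intro mult_left_mono sum_mangoldt_le) auto
  also have "\<dots> = 12 * C" using False by simp
  finally have "\<bar>\<Sum>d=1..N. \<chi> d * mangoldt d / real d * (L - partial_sum (N div d))\<bar> \<le> 12 * C" .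
  moreover have "(\<Sum>d=1..N. \<chi> d * mangoldt d / real d * (L - partial_sum (N div d))) =
      L * (\<Sum>d=1..N. \<chi> d * mangoldt d / real d) - (\<Sum>n=1..N. \<chi> n * (ln (real n) / real n))"
    unfolding log_sum_eq by (simp add: right_diff_distrib diff_divide_distrib sum_subtractf sum_distrib_left mult_ac)
  ultimately show ?thesis using log_sum_bound[of N] by linarith
qed (simp add: C_nonneg)

section \<open>Non-vanishing of L(1, chi) by Monsky's argument\<close>

definition R :: "nat \<Rightarrow> real" where
  "R n = (\<Sum>d | d dvd n. \<chi> d)"

lemma R_prime_power_mult:
  assumes p: "prime p" and m: "\<not> p dvd m"
  shows "R (p ^ k * m) = (\<Sum>i\<le>k. \<chi> p ^ i) * R m"
proof -
  have mult_p: "multiplicity p (p ^ i * d) = i" if "\<not> p dvd d" for i d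
    using p that by (intro multiplicity_eqI) (auto simp: prime_gt_0_nat mult.commute[of p])
  have "R (p ^ k * m) = (\<Sum>(i, d)\<in>{..k} \<times> {d. d dvd m}. \<chi> (p ^ i * d))"
    unfolding R_def
  proof (rule sum.reindex_bij_witness[of _ "\<lambda>(i, d). p ^ i * d"
      "\<lambda>n. (multiplicity p n, n div p ^ multiplicity p n)"])
    fix n assume "n \<in> {d. d dvd p ^ k * m}"
    then have n: "n dvd p ^ k * m" by simp
    obtain y where y: "n = p ^ multiplicity p n * y" "\<not> p dvd y"
    proof (rule multiplicity_decompose')
      show "n \<noteq> 0" using n p m by (auto intro: Nat.gr0I)
      show "\<not> is_unit p" using p by (simp add: prime_nat_iff)
    qed
    have "coprime (p ^ multiplicity p n) m"
      using p m by (simp add: prime_imp_coprime)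
    moreover have "p ^ multiplicity p n dvd p ^ k * m" using n multiplicity_dvd dvd_trans by blast
    ultimately have "p ^ multiplicity p n dvd p ^ k"
      by (simp add: coprime_dvd_mult_left_iff)
    then have le: "multiplicity p n \<le> k"
      using p by (simp add: dvd_power_iff_le prime_ge_2_nat)
    have "coprime y (p ^ k)"
      using p y(2) by (simp add: prime_imp_coprime coprime_commute)
    moreover have "y dvd p ^ k * m" using n y(1) dvd_trans by (metis dvd_triv_right)
    ultimately have "y dvd m" by (simp add: coprime_dvd_mult_right_iff)
    moreover have "n div p ^ multiplicity p n = y"
      using p by (subst y(1)) (simp add: prime_gt_0_nat)
    ultimately show "(multiplicity p n, n div p ^ multiplicity p n) \<in> {..k} \<times> {d. d dvd m}"
      using le by simp
  next
    fix x assume "x \<in> {..k} \<times> {d. d dvd m}"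
    then obtain i d where x: "x = (i, d)" "i \<le> k" "d dvd m" by auto
    have "\<not> p dvd d" using m x(3) dvd_trans by blast
    from mult_p[OF this, of i]
    show "(multiplicity p (case x of (i, d) \<Rightarrow> p ^ i * d),
        (case x of (i, d) \<Rightarrow> p ^ i * d) div p ^ multiplicity p (case x of (i, d) \<Rightarrow> p ^ i * d)) = x"
      using p by (simp add: x(1) prime_gt_0_nat)
    show "(case x of (i, d) \<Rightarrow> p ^ i * d) \<in> {d. d dvd p ^ k * m}"
      using x by (simp add: mult_dvd_mono le_imp_power_dvd)
  qed (auto simp: multiplicity_dvd)
  also have "\<dots> = (\<Sum>i\<le>k. \<Sum>d | d dvd m. \<chi> p ^ i * \<chi> d)"
    by (subst sum.cartesian_product) (simp add: mult power)
  also have "\<dots> = (\<Sum>i\<le>k. \<chi> p ^ i) * R m"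
    by (simp add: R_def sum_product)
  finally show ?thesis .
qed

text \<open>For \<open>\<chi> p = -1\<close> the sums alternate between 1 and 0, which is why the
  stronger bound needs an even upper limit.\<close>

lemma sum_chi_powers: "0 \<le> (\<Sum>i\<le>k. \<chi> p ^ i)" "1 \<le> (\<Sum>i\<le>2*k. \<chi> p ^ i)"
proof -
  have neg: "(\<Sum>i\<le>k. (-1) ^ i) = (if even k then 1 else 0 :: real)" for k :: nat
    by (induction k) auto
  have "0 \<le> (\<Sum>i\<le>k. \<chi> p ^ i) \<and> 1 \<le> (\<Sum>i\<le>2*k. \<chi> p ^ i)"
    using range[of p] by (auto simp: neg power_0_left)
  then show "0 \<le> (\<Sum>i\<le>k. \<chi> p ^ i)" "1 \<le> (\<Sum>i\<le>2*k. \<chi> p ^ i)" by auto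
qed

lemma R_1: "R (Suc 0) = 1"
  by (simp add: R_def one)

text \<open>\<open>R\<close> is the convolution of \<open>\<chi>\<close> with 1. Splitting off full
  prime powers leaves the factors of \<open>sum_chi_powers\<close>, and in a square all exponents
  are even.\<close>

lemma R_bounds: "n > 0 \<Longrightarrow> 0 \<le> R n \<and> 1 \<le> R (n\<^sup>2)"
proof (induction n rule: less_induct)
  case (less n)
  show ?case
  proof (cases "n = 1")
    case True
    then show ?thesis by (simp add: R_1)
  next
    case False
    obtain p where p: "prime p" "p dvd n" using prime_factor_nat[OF False] by blast
    obtain m where m: "n = p ^ multiplicity p n * m" "\<not> p dvd m"
      using multiplicity_decompose'[of n p] less.prems p(1) by (auto simp: prime_nat_iff)
    define k where "k = multiplicity p n"
    have "k > 0" using p less.prems by (simp add: k_def prime_multiplicity_gt_zero_iff)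
    then have "1 < p ^ k" using p(1) one_less_power[of p k] prime_gt_1_nat[of p] by blast
    moreover have m0: "m > 0" using m less.prems by (auto intro: Nat.gr0I)
    ultimately have "1 * m < p ^ k * m" by (intro mult_strict_right_mono)
    then have "m < n" using m(1) by (simp add: k_def)
    note IH = less.IH[OF this m0]
    have n: "n = p ^ k * m" using m(1) by (simp add: k_def)
    have n2: "n\<^sup>2 = p ^ (2 * k) * m\<^sup>2" by (simp add: n power_mult_distrib power_mult mult.commute)
    have "\<not> p dvd m\<^sup>2" using p m(2) by (simp add: prime_dvd_power_iff)
    then have "R (n\<^sup>2) = (\<Sum>i\<le>2*k. \<chi> p ^ i) * R (m\<^sup>2)"
      unfolding n2 by (rule R_prime_power_mult[OF p(1)])
    moreover have "1 * 1 \<le> (\<Sum>i\<le>2*k. \<chi> p ^ i) * R (m\<^sup>2)"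
      by (intro mult_mono sum_chi_powers(2)) (use IH sum_chi_powers(1)[of p "2 * k"] in auto)
    moreover have "R n = (\<Sum>i\<le>k. \<chi> p ^ i) * R m"
      unfolding n by (rule R_prime_power_mult[OF p(1) m(2)])
    ultimately show ?thesis using IH sum_chi_powers(1)[of p k] by simp
  qed
qed

text \<open>Geometric expansion turns the Lambert series of \<open>\<chi>\<close> into the power
  series of \<open>R\<close>. Cutting at \<open>n * k \<le> N\<close> leaves for each
  \<open>n\<close> a tail that starts at exponent \<open>n * (N div n + 1) \<ge> N\<close>.\<close>

lemma R_lambert_bound:
  fixes t :: real
  assumes t: "0 < t" "t < 1"
  shows "\<bar>(\<Sum>n=1..N. \<chi> n * (t ^ n / (1 - t ^ n))) - (\<Sum>n=1..N. R n * t ^ n)\<bar>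
           \<le> real N * t ^ N / (1 - t)"
proof -
  have "(\<Sum>n=1..N. R n * t ^ n) = (\<Sum>n=1..N. \<Sum>d | d dvd n. \<chi> d * t ^ (d * (n div d)))"
    by (intro sum.cong refl) (auto simp: R_def sum_distrib_right intro!: sum.cong)
  also have "\<dots> = (\<Sum>n=1..N. \<Sum>k=1..N div n. \<chi> n * t ^ (n * k))"
    by (rule sum_divisors_swap)
  finally have R: "(\<Sum>n=1..N. R n * t ^ n) = (\<Sum>n=1..N. \<chi> n * (\<Sum>k=1..N div n. (t ^ n) ^ k))"
    by (simp add: sum_distrib_left power_mult)
  have "\<bar>\<Sum>n=1..N. \<chi> n * (t ^ n / (1 - t ^ n) - (\<Sum>k=1..N div n. (t ^ n) ^ k))\<bar>
      \<le> (\<Sum>n=1..N. t ^ N / (1 - t))"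
  proof (rule sum_abs[THEN order_trans], rule sum_mono)
    fix n assume n: "n \<in> {1..N}"
    define u where "u = t ^ n"
    define q where "q = N div n"
    have "u \<le> t ^ 1" unfolding u_def using n t by (intro power_decreasing) auto
    then have u: "0 < u" "u \<le> t" using t by (auto simp: u_def)
    then have u1: "0 < 1 - u" using t by simp
    have "(1 - u) * (\<Sum>k=1..q. u ^ k) = u - u ^ Suc q"
      by (cases "q = 0") (simp_all add: sum_gp_multiplied del: power_Suc)
    then have e: "u / (1 - u) - (\<Sum>k=1..q. u ^ k) = u ^ Suc q / (1 - u)"
      using u1 by (simp add: field_simps)
    have "N \<le> n * Suc q"
      using n dividend_less_times_div[of n N] by (simp add: q_def)
    then have "u ^ Suc q \<le> t ^ N"
      unfolding u_def power_mult[symmetric] using t by (intro power_decreasing) auto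
    then have "u ^ Suc q / (1 - u) \<le> t ^ N / (1 - t)"
      using u t by (intro frac_le) auto
    moreover have "0 \<le> u ^ Suc q / (1 - u)" using u u1 by simp
    ultimately have "\<bar>u ^ Suc q / (1 - u)\<bar> \<le> t ^ N / (1 - t)"
      by (simp only: abs_of_nonneg)
    then have "\<bar>\<chi> n\<bar> * \<bar>u ^ Suc q / (1 - u)\<bar> \<le> 1 * (t ^ N / (1 - t))"
      by (intro mult_mono abs_le_1 abs_ge_zero) auto
    then show "\<bar>\<chi> n * (t ^ n / (1 - t ^ n) - (\<Sum>k=1..N div n. (t ^ n) ^ k))\<bar> \<le> t ^ N / (1 - t)"
      unfolding u_def[symmetric] q_def[symmetric] e abs_mult by (simp only: mult_1)
  qed
  then show ?thesis unfolding R right_diff_distrib sum_subtractf by simp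
qed

text \<open>If \<open>L = 0\<close>, the first part of the weights \<open>b\<close> contributes
  \<open>partial_sum N / (1 - t)\<close>, which vanishes as \<open>N\<close> grows, so Abel
  summation bounds the Lambert series uniformly in \<open>t\<close>. Since \<open>R\<close> is
  nonnegative and at least 1 at squares, the bound passes to the theta-like sum.\<close>

lemma sum_squares_le:
  fixes t :: real
  assumes t: "0 < t" "t < 1" and "L = 0"
  shows "(\<Sum>m=1..K. t ^ (m\<^sup>2)) \<le> 2 * C"
proof -
  define b where "b n = 1 / (real n * (1 - t)) - t ^ n / (1 - t ^ n)" for n
  define err where "err N = 2 * C + 2 * C * inverse (real (Suc N)) / (1 - t) + real N * t ^ N / (1 - t)" for N
  have bound: "(\<Sum>m=1..K. t ^ (m\<^sup>2)) \<le> err N" if "N \<ge> K\<^sup>2" for N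
  proof -
    have inj: "inj_on (\<lambda>m. m\<^sup>2) {1..K}" by (auto simp: inj_on_def)
    have sub: "(\<lambda>m. m\<^sup>2) ` {1..K} \<subseteq> {1..N}"
    proof clarify
      fix m assume m: "m \<in> {1..K}"
      then have "m\<^sup>2 \<le> K\<^sup>2" by (intro power_mono) auto
      then have "m\<^sup>2 \<le> N" using that by (rule order_trans)
      then show "m\<^sup>2 \<in> {1..N}" using m by simp
    qed
    have "1 * t ^ (m\<^sup>2) \<le> R (m\<^sup>2) * t ^ (m\<^sup>2)" if "m \<in> {1..K}" for m
      using t R_bounds[of m] that by (intro mult_right_mono) auto
    then have "(\<Sum>m=1..K. t ^ (m\<^sup>2)) \<le> (\<Sum>m=1..K. R (m\<^sup>2) * t ^ (m\<^sup>2))"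
      by (intro sum_mono) simp
    also have "\<dots> = (\<Sum>n\<in>(\<lambda>m. m\<^sup>2) ` {1..K}. R n * t ^ n)"
      by (subst sum.reindex[OF inj]) (simp add: o_def)
    also have "\<dots> \<le> (\<Sum>n=1..N. R n * t ^ n)"
      using sub t R_bounds by (intro sum_mono2) auto
    finally have 1: "(\<Sum>m=1..K. t ^ (m\<^sup>2)) \<le> (\<Sum>n=1..N. R n * t ^ n)" .
    have "\<bar>\<Sum>n\<in>{0<..N}. \<chi> n * b n\<bar> \<le> 2 * C * b (Suc 0)"
      by (rule abel_sum_bound[OF bounded]) (use monsky_weights[OF t] in \<open>auto simp only: b_def\<close>)
    moreover have "b (Suc 0) = 1" using t by (simp add: b_def diff_divide_distrib[symmetric])
    moreover have "{0<..N} = {1..N}" by auto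
    ultimately have 2: "\<bar>\<Sum>n=1..N. \<chi> n * b n\<bar> \<le> 2 * C" by simp
    have "(\<Sum>n=1..N. \<chi> n * b n) = partial_sum N / (1 - t) - (\<Sum>n=1..N. \<chi> n * (t ^ n / (1 - t ^ n)))"
      by (simp add: b_def partial_sum_def right_diff_distrib sum_subtractf sum_divide_distrib)
    moreover have "\<bar>partial_sum N\<bar> / (1 - t) \<le> 2 * C * inverse (real (Suc N)) / (1 - t)"
      using L_approx[of N] t \<open>L = 0\<close> by (intro divide_right_mono) (simp_all add: divide_inverse)
    moreover have "\<bar>partial_sum N / (1 - t)\<bar> = \<bar>partial_sum N\<bar> / (1 - t)"
      using t by simp
    ultimately show ?thesis
      using 1 2 R_lambert_bound[OF t, of N] unfolding err_def by linarith
  qed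
  \<comment> \<open>\<open>t\<close> is fixed while \<open>N\<close> tends to infinity; only the
    \<open>2 * C\<close> of Abel summation with \<open>b (Suc 0) = 1\<close> survives.\<close>
  have "err \<longlonglongrightarrow> 2 * C + 2 * C * 0 / (1 - t) + 0 / (1 - t)"
    unfolding err_def
    using t by (intro tendsto_add tendsto_divide tendsto_mult[OF tendsto_const]
      tendsto_const LIMSEQ_inverse_real_of_nat powser_times_n_limit_0) simp_all
  then have "err \<longlonglongrightarrow> 2 * C" by simp
  then show ?thesis
    by (rule LIMSEQ_le_const) (intro exI[of _ "K\<^sup>2"] allI impI bound)
qed

lemma L_nonzero: "L \<noteq> 0"
proof
  assume L: "L = 0"
  obtain K :: nat where K: "4 * C + 1 < real K" using reals_Archimedean2 by blast
  then have K0: "real K > 1" using C_nonneg by linarith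
  \<comment> \<open>By Bernoulli's inequality \<open>t ^ (K ^ 2) \<ge> 1 / 2\<close>, so the
    \<open>K\<close> terms sum to at least \<open>K / 2\<close>, which exceeds \<open>2 * C\<close>
    by the choice of \<open>K\<close>.\<close>
  define t where "t = 1 - 1 / (2 * (real K)\<^sup>2)"
  define x where "x = (real K)\<^sup>2"
  have "1 < x" using K0 unfolding x_def by (intro one_less_power) auto
  then have t: "0 < t" "t < 1" by (auto simp: t_def x_def[symmetric] divide_simps)
  have "1 + real (K\<^sup>2) * (- (1 / (2 * (real K)\<^sup>2))) \<le> (1 + - (1 / (2 * (real K)\<^sup>2))) ^ (K\<^sup>2)"
    using t by (intro Bernoulli_inequality) (simp add: t_def)
  moreover have "real (K\<^sup>2) * (- (1 / (2 * (real K)\<^sup>2))) = - 1 / 2" using K0 by simp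
  ultimately have "1 / 2 \<le> t ^ (K\<^sup>2)" by (simp add: t_def)
  moreover have "t ^ (K\<^sup>2) \<le> t ^ (m\<^sup>2)" if "m \<in> {1..K}" for m
    using t that by (intro power_decreasing power_mono) auto
  ultimately have "(\<Sum>m=1..K. 1 / 2) \<le> (\<Sum>m=1..K. t ^ (m\<^sup>2))"
    by (intro sum_mono) force
  then show False using sum_squares_le[OF t L, of K] K C_nonneg by simp
qed

lemma mangoldt_sum_bounded: "\<exists>B. \<forall>N. \<bar>\<Sum>d=1..N. \<chi> d * mangoldt d / real d\<bar> \<le> B"
proof (intro exI allI)
  fix N
  have "\<bar>L\<bar> > 0" using L_nonzero by simp
  then show "\<bar>\<Sum>d=1..N. \<chi> d * mangoldt d / real d\<bar> \<le> 16 * C / \<bar>L\<bar>"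
    using mangoldt_sum_bound[of N] unfolding abs_mult by (subst pos_le_divide_eq) (auto simp only: mult.commute)
qed

end

text \<open>Expand \<open>F\<close> over the subsets of \<open>I\<close>: the empty set contributes
  \<open>ln N\<close> up to a constant, every other subset a bounded sum. If no prime qualified,
  \<open>F\<close> would vanish at all primes above \<open>b\<close>, and small integers and prime
  powers alone would keep the sum bounded. The value 0 has to be allowed because then the factor is
  1.\<close>

theorem prime_with_character_values:
  fixes \<chi> :: "'i \<Rightarrow> nat \<Rightarrow> real" and \<epsilon> :: "'i \<Rightarrow> real" and b :: nat
  assumes "finite I"
    and char: "\<And>S. S \<subseteq> I \<Longrightarrow> S \<noteq> {} \<Longrightarrow> \<exists>C. real_character (\<lambda>n. \<Prod>i\<in>S. \<chi> i n) C"
    and eps: "\<And>i. i \<in> I \<Longrightarrow> \<epsilon> i \<in> {-1, 1}"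
  shows "\<exists>q. prime q \<and> q > b \<and> (\<forall>i\<in>I. \<chi> i q \<in> {\<epsilon> i, 0})"
proof (rule ccontr)
  assume contra: "\<not> ?thesis"
  have range: "\<chi> i n \<in> {-1, 0, 1}" if "i \<in> I" for i n
    using char[of "{i}"] that real_character.range by fastforce
  define F where "F n = (\<Prod>i\<in>I. \<epsilon> i * \<chi> i n + 1)" for n
  define c where "c S = (\<Prod>i\<in>S. \<epsilon> i)" for S
  define T where "T S N = (\<Sum>n=1..N. (\<Prod>i\<in>S. \<chi> i n) * mangoldt n / real n)" for S N
  have F_bounds: "0 \<le> F n" "F n \<le> 2 ^ card I" for n
  proof -
    have "\<epsilon> i * \<chi> i n + 1 \<in> {0..2}" if "i \<in> I" for i
      using range[OF that, of n] eps[OF that] by auto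
    then show "0 \<le> F n" "F n \<le> 2 ^ card I"
      unfolding F_def using prod_mono[of I "\<lambda>i. \<epsilon> i * \<chi> i n + 1" "\<lambda>_. 2"] by (auto intro!: prod_nonneg)
  qed
  have F_prime: "F q = 0" if q: "prime q" "q > b" for q
  proof -
    obtain i where i: "i \<in> I" "\<chi> i q \<notin> {\<epsilon> i, 0}" using contra q by blast
    then have "\<epsilon> i * \<chi> i q + 1 = 0" using range[OF i(1), of q] eps[OF i(1)] by auto
    then show ?thesis using i(1) \<open>finite I\<close> by (auto simp: F_def)
  qed
  have "\<exists>B. \<forall>N. \<bar>T S N\<bar> \<le> B" if "S \<in> Pow I - {{}}" for S
    using char[of S] that unfolding T_def by (blast dest: real_character.mangoldt_sum_bounded)
  then obtain B where B: "\<And>S N. S \<in> Pow I - {{}} \<Longrightarrow> \<bar>T S N\<bar> \<le> B S" by metis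
  have "(\<Sum>n=1..N. F n * mangoldt n / real n) = (\<Sum>S\<in>Pow I. c S * T S N)" for N
  proof -
    have "F n = (\<Sum>S\<in>Pow I. c S * (\<Prod>i\<in>S. \<chi> i n))" for n
      unfolding F_def c_def by (subst prod_add[OF \<open>finite I\<close>]) (simp add: prod.distrib)
    then have "(\<Sum>n=1..N. F n * mangoldt n / real n) =
        (\<Sum>n=1..N. \<Sum>S\<in>Pow I. c S * ((\<Prod>i\<in>S. \<chi> i n) * mangoldt n / real n))"
      by (simp add: sum_distrib_right sum_divide_distrib mult.assoc)
    also have "\<dots> = (\<Sum>S\<in>Pow I. c S * T S N)"
      unfolding T_def sum_distrib_left by (rule sum.swap)
    finally show ?thesis .
  qed
  also have "(\<Sum>S\<in>Pow I. c S * T S N) = T {} N + (\<Sum>S\<in>Pow I - {{}}. c S * T S N)" for N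
    using \<open>finite I\<close> by (subst sum.remove[of _ "{}"]) (auto simp: c_def)
  finally have expand: "(\<Sum>n=1..N. F n * mangoldt n / real n) =
      T {} N + (\<Sum>S\<in>Pow I - {{}}. c S * T S N)" for N .
  have "\<bar>c S * T S N\<bar> \<le> B S" if "S \<in> Pow I - {{}}" for S N
  proof -
    have "\<bar>c S\<bar> = (\<Prod>i\<in>S. \<bar>\<epsilon> i\<bar>)" unfolding c_def by (rule abs_prod)
    also have "\<dots> = 1" using eps that by (intro prod.neutral) fastforce
    finally show ?thesis using B[OF that, of N] by (simp add: abs_mult)
  qed
  then have rest: "\<bar>\<Sum>S\<in>Pow I - {{}}. c S * T S N\<bar> \<le> (\<Sum>S\<in>Pow I - {{}}. B S)" for N
    by (intro sum_abs[THEN order_trans] sum_mono)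
  define D where "D = (\<Sum>n=1..b. 2 ^ card I * (mangoldt n / real n)) + 2 ^ card I * 2"
  have upper: "(\<Sum>n=1..N. F n * mangoldt n / real n) \<le> D" for N
  proof -
    have le: "F n * mangoldt n / real n \<le> 2 ^ card I * (mangoldt n / real n)" for n
      using mult_right_mono[OF F_bounds(2)[of n], of "mangoldt n / real n"] by (simp add: mangoldt_nonneg)
    have nonneg: "0 \<le> F n * mangoldt n / real n" for n
      using F_bounds(1)[of n] by (simp add: mangoldt_nonneg)
    define W where "W n = 2 ^ card I * (mangoldt n / real n)" for n :: nat
    have W: "0 \<le> W n" for n by (simp add: W_def mangoldt_nonneg)
    have "F n * mangoldt n / real n \<le> (if n \<le> b then W n else 0) + (if \<not> prime n then W n else 0)" for n
      using le[of n, folded W_def] W[of n] F_prime[of n] by (cases "n \<le> b"; cases "prime n") auto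
    then have "(\<Sum>n=1..N. F n * mangoldt n / real n)
        \<le> (\<Sum>n=1..N. if n \<le> b then W n else 0) + (\<Sum>n=1..N. if \<not> prime n then W n else 0)"
      unfolding sum.distrib[symmetric] by (intro sum_mono)
    also have "(\<Sum>n=1..N. if n \<le> b then W n else 0) = (\<Sum>n | n \<in> {1..N} \<and> n \<le> b. W n)"
      by (rule sum.inter_filter[symmetric]) simp
    also have "(\<Sum>n=1..N. if \<not> prime n then W n else 0) = 2 ^ card I * (\<Sum>n | n \<in> {1..N} \<and> \<not> prime n. mangoldt n / real n)"
      unfolding sum_distrib_left W_def by (rule sum.inter_filter[symmetric]) simp
    finally have "(\<Sum>n=1..N. F n * mangoldt n / real n) \<le> (\<Sum>n | n \<in> {1..N} \<and> n \<le> b. W n)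
        + 2 ^ card I * (\<Sum>n | n \<in> {1..N} \<and> \<not> prime n. mangoldt n / real n)" .
    moreover have "(\<Sum>n | n \<in> {1..N} \<and> n \<le> b. W n) \<le> (\<Sum>n=1..b. W n)"
      using W by (intro sum_mono2) auto
    moreover have "2 ^ card I * (\<Sum>n | n \<in> {1..N} \<and> \<not> prime n. mangoldt n / real n) \<le> 2 ^ card I * (2 :: real)"
      by (intro mult_left_mono sum_mangoldt_not_prime_le) simp
    ultimately show ?thesis unfolding D_def W_def by linarith
  qed
  obtain N :: nat where N: "exp (D + (\<Sum>S\<in>Pow I - {{}}. B S) + 1) < real N"
    using reals_Archimedean2 by blast
  then have N0: "0 < real N" using exp_gt_zero less_trans by blast
  then have "D + (\<Sum>S\<in>Pow I - {{}}. B S) + 1 < ln (real N)"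
    using N by (subst exp_less_cancel_iff[symmetric]) simp
  moreover have "ln (real N) - 1 \<le> T {} N"
    using sum_mangoldt_over_ge[of N] N0 by (simp add: T_def)
  ultimately show False using expand[of N] upper[of N] rest[of N] by linarith
qed

text \<open>Multiplication by \<open>a\<close> permutes the residues modulo \<open>k\<close> and
  flips the sign of \<open>\<chi>\<close>, so the sum over a full period is 0.\<close>

lemma real_character_periodic:
  fixes \<chi> :: "nat \<Rightarrow> real"
  assumes mult: "\<And>a b. \<chi> (a * b) = \<chi> a * \<chi> b"
    and one: "\<chi> (Suc 0) = 1"
    and range: "\<And>n. \<chi> n \<in> {-1, 0, 1}"
    and periodic: "\<And>n. \<chi> (n + k) = \<chi> n"
    and k: "k > 0" and a: "coprime a k" "\<chi> a = -1"
  shows "real_character \<chi> (real k)"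
proof
  have abs_le: "\<bar>\<chi> n\<bar> \<le> 1" for n using range[of n] by auto
  have mod: "\<chi> (n mod k) = \<chi> n" for n
  proof -
    have "\<chi> (r + q * k) = \<chi> r" for r q
    proof (induction q)
      case (Suc q)
      have "\<chi> (r + Suc q * k) = \<chi> ((r + q * k) + k)" by (simp add: algebra_simps)
      then show ?case using Suc periodic by simp
    qed simp
    from this[of "n mod k" "n div k"] show ?thesis by simp
  qed
  have inj: "inj_on (\<lambda>n. a * n mod k) {..<k}"
  proof (rule inj_onI)
    fix x y assume xy: "x \<in> {..<k}" "y \<in> {..<k}" "a * x mod k = a * y mod k"
    then have "[a * x = a * y] (mod k)" by (simp add: cong_def)
    then have "[x = y] (mod k)" using a(1) by (simp add: cong_mult_lcancel_nat)
    then show "x = y" using xy by (simp add: cong_def)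
  qed
  moreover have "(\<lambda>n. a * n mod k) ` {..<k} \<subseteq> {..<k}" using k by auto
  ultimately have "(\<lambda>n. a * n mod k) ` {..<k} = {..<k}" by (intro endo_inj_surj) auto
  then have "(\<Sum>n<k. \<chi> n) = (\<Sum>n<k. \<chi> (a * n mod k))"
    using sum.reindex[OF inj, of \<chi>] by simp
  also have "\<dots> = - (\<Sum>n<k. \<chi> n)"
    by (simp add: mod mult a(2) sum_negf)
  finally have zero: "(\<Sum>n<k. \<chi> n) = 0" by simp
  have shift: "(\<Sum>n<M + k. \<chi> n) = (\<Sum>n<M. \<chi> n)" for M
    by (induction M) (simp_all add: zero periodic)
  have bound: "\<bar>\<Sum>n<N. \<chi> n\<bar> \<le> real k" for N
  proof (induction N rule: less_induct)
    case (less N)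
    show ?case
    proof (cases "N \<le> k")
      case True
      have "\<bar>\<Sum>n<N. \<chi> n\<bar> \<le> (\<Sum>n<N. 1)"
        by (rule sum_abs[THEN order_trans], rule sum_mono) (use abs_le in blast)
      then show ?thesis using True by simp
    next
      case False
      then show ?thesis using less.IH[of "N - k"] shift[of "N - k"] k by simp
    qed
  qed
  have "\<chi> 0 = 0" using mult[of a 0] a(2) by simp
  fix N
  have "{..<Suc N} = insert 0 {1..N}" by auto
  then have "(\<Sum>n<Suc N. \<chi> n) = (\<Sum>n=1..N. \<chi> n)" using \<open>\<chi> 0 = 0\<close> by (subst \<open>{..<Suc N} = _\<close>) simp
  then show "\<bar>\<Sum>n=1..N. \<chi> n\<bar> \<le> real k" using bound[of "Suc N"] by simp
qed (use mult one range in auto)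

section \<open>Primes with prescribed Legendre symbols\<close>

lemma Legendre_range: "Legendre a p \<in> {-1, 0, 1}"
  by (simp add: Legendre_def)

lemma Legendre_cong: "[a = b] (mod p) \<Longrightarrow> Legendre a p = Legendre b p"
  by (simp add: Legendre_def QuadRes_def cong_def)

lemma Legendre_1: "1 < p \<Longrightarrow> Legendre 1 p = 1"
  by (auto simp: Legendre_def QuadRes_def cong_0_iff intro!: exI[of _ 1])

text \<open>Turns the congruences of Euler's criterion into equations: values in
  \<open>{-1, 0, 1}\<close> differ by at most 2, less than an odd prime.\<close>

lemma cong_small_eq:
  fixes x y p :: int
  assumes "[x = y] (mod p)" "\<bar>x - y\<bar> < p"
  shows "x = y"
proof -
  have "p dvd x - y" using assms(1) by (simp add: cong_iff_dvd_diff)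
  then show ?thesis using assms(2) dvd_imp_le_int[of "x - y" p] by (cases "x = y") auto
qed

lemma Legendre_mult:
  fixes p :: nat
  assumes "prime p" "2 < p"
  shows "Legendre (a * b) p = Legendre a p * Legendre b p"
proof (rule cong_small_eq)
  have "[Legendre (a * b) p = (a * b) ^ ((p - 1) div 2)] (mod p)"
    by (rule euler_criterion[OF assms])
  moreover have "[Legendre a p * Legendre b p = a ^ ((p - 1) div 2) * b ^ ((p - 1) div 2)] (mod p)"
    by (intro cong_mult euler_criterion[OF assms])
  ultimately show "[Legendre (a * b) p = Legendre a p * Legendre b p] (mod p)"
    unfolding power_mult_distrib by (meson cong_sym cong_trans)
  have "Legendre (a * b) p \<in> {-1, 0, 1}" "Legendre a p * Legendre b p \<in> {-1, 0, 1}"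
    using Legendre_range[of "a * b" p] Legendre_range[of a p] Legendre_range[of b p] by auto
  then show "\<bar>Legendre (a * b) p - Legendre a p * Legendre b p\<bar> < p"
    using assms(2) by auto
qed

text \<open>Otherwise squaring would be surjective on the residues modulo \<open>p\<close>, hence
  injective, although 1 and \<open>p - 1\<close> have the same square.\<close>

lemma Legendre_nonresidue:
  fixes p :: nat
  assumes p: "prime p" "2 < p"
  shows "\<exists>a::nat. Legendre a p = -1"
proof (rule ccontr)
  assume contra: "\<not> ?thesis"
  have res: "\<exists>y::nat. y < p \<and> y\<^sup>2 mod p = a" if a: "a < p" for a
  proof (cases "a = 0")
    case False
    then have "\<not> [int a = 0] (mod int p)" using a by (auto simp: cong_int_iff[of a 0, simplified] cong_def)
    then have "QuadRes p a" using contra by (auto simp: Legendre_def split: if_splits)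
    then obtain y where y: "[y\<^sup>2 = int a] (mod int p)" unfolding QuadRes_def by blast
    define z where "z = nat (y mod int p)"
    have z: "int z = y mod int p" using p by (simp add: z_def)
    have "[(int z)\<^sup>2 = int a] (mod int p)"
      using y unfolding z by (simp add: cong_def power_mod)
    then have "[z\<^sup>2 = a] (mod p)" by (simp flip: cong_int_iff)
    then have "z\<^sup>2 mod p = a" using a by (simp add: cong_def)
    moreover have "int z < int p" unfolding z using p by (intro pos_mod_bound) auto
    ultimately show ?thesis by auto
  qed (use p in \<open>auto intro!: exI[of _ 0]\<close>)
  then have "{..<p} \<subseteq> (\<lambda>y. y\<^sup>2 mod p) ` {..<p}" by force
  then have "(\<lambda>y. y\<^sup>2 mod p) ` {..<p} = {..<p}" using p by auto
  then have inj: "inj_on (\<lambda>y. y\<^sup>2 mod p) {..<p}"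
    by (intro eq_card_imp_inj_on) auto
  have "(p - 1)\<^sup>2 mod p = 1\<^sup>2 mod p"
  proof -
    have "[int (p - 1) = -1] (mod int p)" using p by (simp add: of_nat_diff cong_iff_dvd_diff)
    then have "[(int (p - 1))\<^sup>2 = (-1)\<^sup>2] (mod int p)" by (rule cong_pow)
    then have "[int ((p - 1)\<^sup>2) = int (1\<^sup>2)] (mod int p)" by simp
    then show ?thesis unfolding cong_int_iff by (simp only: cong_def)
  qed
  then have "p - 1 = 1" using inj_onD[OF inj, of "p - 1" 1] p by simp
  then show False using p by simp
qed

text \<open>The character modulo 4, written modulo 8 to share its period with \<open>chi8\<close>,
  the Jacobi symbol of 2. The two values together determine an odd residue modulo 8.\<close>

definition chi4 :: "nat \<Rightarrow> real" where
  "chi4 n = (if n mod 8 \<in> {1, 5} then 1 else if n mod 8 \<in> {3, 7} then -1 else 0)"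

definition chi8 :: "nat \<Rightarrow> real" where
  "chi8 n = (if n mod 8 \<in> {1, 7} then 1 else if n mod 8 \<in> {3, 5} then -1 else 0)"

lemma mod_cases_8: "n mod 8 \<in> {0, 1, 2, 3, 4, 5, 6, 7::nat}"
proof -
  have "r < 8 \<Longrightarrow> r \<in> {0, 1, 2, 3, 4, 5, 6, 7}" for r :: nat by auto
  then show ?thesis by simp
qed

lemma chi4_mult: "chi4 (a * b) = chi4 a * chi4 b"
proof -
  have e: "a * b mod 8 = (a mod 8) * (b mod 8) mod 8" by (simp only: mod_mult_eq)
  show ?thesis unfolding chi4_def e using mod_cases_8[of a] mod_cases_8[of b]
    by (elim insertE emptyE) simp_all
qed

lemma chi8_mult: "chi8 (a * b) = chi8 a * chi8 b"
proof -
  have e: "a * b mod 8 = (a mod 8) * (b mod 8) mod 8" by (simp only: mod_mult_eq)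
  show ?thesis unfolding chi8_def e using mod_cases_8[of a] mod_cases_8[of b]
    by (elim insertE emptyE) simp_all
qed

text \<open>The indices 0 and 1 stand for the two characters modulo 8; no confusion with the
  Legendre symbols arises since 0 and 1 are not prime.\<close>
definition quad_char :: "nat \<Rightarrow> nat \<Rightarrow> real" where
  "quad_char i n = (if i = 0 then chi4 n else if i = 1 then chi8 n else of_int (Legendre n i))"

lemma quad_char_range: "quad_char i n \<in> {-1, 0, 1}"
  using Legendre_range[of n i] by (auto simp: quad_char_def chi4_def chi8_def)

text \<open>The product is periodic modulo \<open>8 * \<Prod>P\<close>. That it takes the value -1
  is shown by the Chinese remainder theorem: some \<open>a\<close> has the value -1 at one index
  \<open>j\<close> of \<open>S\<close> and 1 at all other indices.\<close>

lemma quad_char_product: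
  assumes P: "finite P" "\<And>p. p \<in> P \<Longrightarrow> prime p \<and> 2 < p"
    and S: "S \<subseteq> insert 0 (insert 1 P)" "S \<noteq> {}"
  shows "\<exists>C. real_character (\<lambda>n. \<Prod>i\<in>S. quad_char i n) C"
proof -
  have S_prime: "prime i \<and> 2 < i" if "i \<in> S" "i \<noteq> 0" "i \<noteq> 1" for i
    using that S(1) P(2) by auto
  have "finite S" using P(1) S(1) finite_subset by blast
  define k where "k = 8 * \<Prod>P"
  have "k > 0" using P by (auto simp: k_def prod_pos prime_gt_0_nat intro!: Nat.gr0I)
  have cong: "quad_char i m = quad_char i n" if "i \<in> insert 0 (insert 1 P)" "[m = n] (mod 8)" "\<And>p. p \<in> P \<Longrightarrow> [m = n] (mod p)" for i m n
  proof -
    have "m mod 8 = n mod 8" using that(2) by (simp add: cong_def)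
    moreover have "Legendre (int m) (int i) = Legendre (int n) (int i)" if "i \<in> P"
      using \<open>\<And>p. p \<in> P \<Longrightarrow> [m = n] (mod p)\<close>[OF that] by (intro Legendre_cong) (simp add: cong_int_iff)
    ultimately show ?thesis
      using that(1) by (auto simp: quad_char_def chi4_def chi8_def)
  qed
  obtain j where j: "j \<in> S" using S(2) by blast
  \<comment> \<open>At 7 only \<open>chi4\<close> is -1, at 5 only \<open>chi8\<close>; for a prime
    index any nonresidue serves.\<close>
  obtain r :: nat where r: "r \<noteq> 1" "j \<noteq> 0 \<Longrightarrow> j \<noteq> 1 \<Longrightarrow> Legendre r j = -1"
      "j = 0 \<or> j = 1 \<Longrightarrow> r = (if j = 0 then 7 else 5)"
  proof (cases "j = 0 \<or> j = 1")
    case True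
    then show ?thesis by (intro that[of "if j = 0 then 7 else 5"]) auto
  next
    case False
    then obtain a :: nat where a: "Legendre a j = -1" using Legendre_nonresidue S_prime[OF j] by blast
    have "Legendre 1 j = 1" using S_prime[OF j] False by (intro Legendre_1) auto
    then have "a \<noteq> 1" using a by auto
    then show ?thesis using a False by (intro that[of a]) auto
  qed
  \<comment> \<open>The prescribed residues: \<open>r\<close> at the modulus that belongs to
    \<open>j\<close>, and 1 at all others.\<close>
  define u where "u m = (if m = (if j = 0 \<or> j = 1 then 8 else j) then r else 1)" for m :: nat
  have "\<forall>x\<in>insert 8 P. \<forall>y\<in>insert 8 P. x \<noteq> y \<longrightarrow> coprime (id x) (id y)"
  proof (intro ballI impI)
    have co8: "coprime 8 p" if "p \<in> P" for p :: nat
    proof -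
      have "odd p" using P(2)[OF that] primes_dvd_imp_eq two_is_prime_nat by (metis less_irrefl)
      then have "coprime (2 ^ 3) p" by (subst coprime_power_left_iff) simp
      then show ?thesis by simp
    qed
    fix x y assume "x \<in> insert 8 P" "y \<in> insert 8 P" "x \<noteq> y"
    then show "coprime (id x) (id y)"
      using co8 P(2) by (auto simp: coprime_commute primes_coprime)
  qed
  then have "\<exists>a. \<forall>m\<in>insert 8 P. [a = u m] (mod id m)"
    by (intro chinese_remainder_nat) (use P(1) in auto)
  then obtain a where a: "\<And>m. m \<in> insert 8 P \<Longrightarrow> [a = u m] (mod m)"
    unfolding id_def by blast
  have "\<not> prime (8 :: nat)" using primes_dvd_imp_eq[of 2 "8 :: nat"] two_is_prime_nat by auto
  then have "8 \<notin> P" using P(2)[of 8] by blast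
  have quad_1: "quad_char i 1 = 1" if "i \<in> insert 0 (insert 1 P)" for i
    using that P(2)[of i] by (auto simp: quad_char_def chi4_def chi8_def Legendre_1)
  have at_a: "quad_char i a = (if i = j then -1 else 1)" if i: "i \<in> insert 0 (insert 1 P)" for i
  proof (cases "i = 0 \<or> i = 1")
    case True
    have "a mod 8 = u 8 mod 8" using a[of 8] by (simp add: cong_def)
    moreover have "j \<noteq> 8" using j S(1) \<open>8 \<notin> P\<close> by auto
    ultimately show ?thesis using True r(3)
      by (auto simp: u_def quad_char_def chi4_def chi8_def split: if_splits)
  next
    case False
    then have "i \<in> P" using i by simp
    then have "[a = u i] (mod i)" "i \<noteq> 8" using a \<open>8 \<notin> P\<close> by auto
    then have "Legendre a i = Legendre (u i) i" by (intro Legendre_cong) (simp add: cong_int_iff)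
    moreover have "Legendre (int (Suc 0)) i = 1" using quad_1[OF i] False by (simp add: quad_char_def)
    ultimately show ?thesis using False r(2) \<open>i \<noteq> 8\<close> by (auto simp: quad_char_def u_def)
  qed
  have "coprime a k"
  proof -
    have "chi4 a \<noteq> 0" using at_a[of 0] by (auto simp: quad_char_def split: if_splits)
    then have "a mod 8 \<in> {1, 3, 5, 7}" by (auto simp: chi4_def split: if_splits)
    then have "odd a" unfolding insert_iff empty_iff by presburger
    then have "coprime a (2 ^ 3)" by (subst coprime_power_right_iff) simp
    moreover have "coprime a p" if "p \<in> P" for p
    proof -
      have "Legendre a p \<noteq> 0" using at_a[of p] that P(2)[OF that] by (auto simp: quad_char_def split: if_splits)
      then have "\<not> p dvd a" by (auto simp: Legendre_def cong_0_iff split: if_splits)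
      then show ?thesis using P(2)[OF that] prime_imp_coprime[of p a] by (metis coprime_commute)
    qed
    ultimately show ?thesis unfolding k_def by (simp add: prod_coprime_right)
  qed
  have "real_character (\<lambda>n. \<Prod>i\<in>S. quad_char i n) (real k)"
  proof (rule real_character_periodic)
    fix m n
    show "(\<Prod>i\<in>S. quad_char i (m * n)) = (\<Prod>i\<in>S. quad_char i m) * (\<Prod>i\<in>S. quad_char i n)"
      unfolding prod.distrib[symmetric]
      by (intro prod.cong refl) (use S_prime in \<open>auto simp: quad_char_def chi4_mult chi8_mult Legendre_mult\<close>)
    show "(\<Prod>i\<in>S. quad_char i n) \<in> {-1, 0, 1}"
      using \<open>finite S\<close> quad_char_range by (induction S rule: finite_induct) fastforce+
    show "(\<Prod>i\<in>S. quad_char i (n + k)) = (\<Prod>i\<in>S. quad_char i n)"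
    proof (intro prod.cong refl cong)
      show "[n + k = n] (mod 8)" by (simp add: cong_def k_def)
      show "[n + k = n] (mod p)" if "p \<in> P" for p
        using dvd_prodI[OF P(1) that, of id] by (simp add: cong_def k_def mod_add_right_eq[symmetric] mod_eq_0_iff_dvd[THEN iffD2])
    qed (use S(1) in auto)
  next
    show "(\<Prod>i\<in>S. quad_char i (Suc 0)) = 1" using quad_1 S(1) by (intro prod.neutral) auto
    show "(\<Prod>i\<in>S. quad_char i a) = -1"
    proof -
      have "(\<Prod>i\<in>S - {j}. quad_char i a) = 1"
      proof (intro prod.neutral ballI)
        fix i assume i: "i \<in> S - {j}"
        then have "i \<in> insert 0 (insert 1 P)" using S(1) by blast
        from at_a[OF this] show "quad_char i a = 1" using i by simp
      qed
      moreover have "quad_char j a = -1" using at_a[of j] j S(1) by auto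
      ultimately show ?thesis using prod.remove[OF \<open>finite S\<close> j, of "\<lambda>i. quad_char i a"] by simp
    qed
  qed fact+
  then show ?thesis ..
qed

theorem prime_with_Legendre_values:
  fixes P :: "nat set"
  assumes P: "finite P" "\<And>p. p \<in> P \<Longrightarrow> prime p \<and> 2 < p"
    and eps: "\<And>p. p \<in> P \<Longrightarrow> \<epsilon> p \<in> {-1, 1 :: int}"
    and r: "r \<in> {1, 3, 5, 7 :: nat}"
  shows "\<exists>q::nat. prime q \<and> q > b \<and> q mod 8 = r \<and> (\<forall>p\<in>P. Legendre q p = \<epsilon> p)"
proof -
  define e where "e i = (if i = 0 then chi4 r else if i = 1 then chi8 r else of_int (\<epsilon> i))" for i
  \<comment> \<open>The lower bound makes \<open>q\<close> odd and different from all primes in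
    \<open>P\<close>, which excludes the character value 0.\<close>
  have "\<exists>q. prime q \<and> q > b + 2 + \<Sum>P \<and> (\<forall>i\<in>insert 0 (insert 1 P). quad_char i q \<in> {e i, 0})"
  proof (rule prime_with_character_values)
    show "e i \<in> {-1, 1}" if "i \<in> insert 0 (insert 1 P)" for i
    proof (cases "i = 0 \<or> i = 1")
      case True
      then show ?thesis using r by (auto simp: e_def chi4_def chi8_def)
    next
      case False
      then show ?thesis using that eps[of i] by (auto simp: e_def)
    qed
  qed (use P quad_char_product in auto)
  then obtain q where q: "prime q" "q > b + 2 + \<Sum>P"
    "\<And>i. i \<in> insert 0 (insert 1 P) \<Longrightarrow> quad_char i q \<in> {e i, 0}" by blast
  have "odd q" using q(1,2) prime_odd_nat by auto
  then have "q mod 8 \<in> {1, 3, 5, 7}" unfolding insert_iff empty_iff by presburger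
  then have "q mod 8 = r"
    using q(3)[of 0] q(3)[of 1] r by (auto simp: quad_char_def e_def chi4_def chi8_def)
  moreover have "Legendre q p = \<epsilon> p" if "p \<in> P" for p
  proof -
    have "p \<le> \<Sum>P" using P(1) that by (intro member_le_sum[where f = "\<lambda>x. x"]) auto
    then have "p \<noteq> q" using q(2) by linarith
    then have "\<not> p dvd q" using P(2)[OF that] q(1) primes_dvd_imp_eq by blast
    then have "Legendre q p \<noteq> 0" by (simp add: Legendre_def cong_0_iff)
    then show ?thesis using q(3)[of p] that P(2)[OF that] by (auto simp: quad_char_def e_def split: if_splits)
  qed
  ultimately show ?thesis using q(1,2) by (intro exI[of _ q]) auto
qed

section \<open>Sums of three squares\<close>

text \<open>A positive definite ternary form is reduced by alternately reducing the binary form in the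
  first two variables and the corresponding binary form of the adjoint, as in Gauss.\<close>

definition tern :: "int \<Rightarrow> int \<Rightarrow> int \<Rightarrow> int \<Rightarrow> int \<Rightarrow> int \<Rightarrow> int \<Rightarrow> int \<Rightarrow> int \<Rightarrow> int" where
  "tern a b c d e f x y z =
     a * x\<^sup>2 + b * y\<^sup>2 + c * z\<^sup>2 + 2 * d * y * z + 2 * e * x * z + 2 * f * x * y"

lemma nearest_multiple:
  fixes m k :: int
  assumes "m > 0"
  shows "\<exists>t. 4 * (k + t * m)\<^sup>2 \<le> m\<^sup>2"
proof (intro exI)
  define t where "t = - ((2 * k + m) div (2 * m))"
  have "2 * k + m = (2 * m) * ((2 * k + m) div (2 * m)) + (2 * k + m) mod (2 * m)" by simp
  moreover have "0 \<le> (2 * k + m) mod (2 * m)" "(2 * k + m) mod (2 * m) < 2 * m"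
    using assms by (auto intro: pos_mod_sign pos_mod_bound)
  ultimately have "- m \<le> 2 * (k + t * m)" "2 * (k + t * m) \<le> m"
    unfolding t_def by (auto simp: algebra_simps)
  then have "\<bar>2 * (k + t * m)\<bar> \<le> m" by linarith
  then have "\<bar>2 * (k + t * m)\<bar>\<^sup>2 \<le> m\<^sup>2" by (intro power_mono) auto
  then show "4 * (k + t * m)\<^sup>2 \<le> m\<^sup>2" by (simp only: power2_abs power_mult_distrib) simp
qed

lemma tern_one_sum_three_squares:
  assumes "a > 0" "a * b - f\<^sup>2 > 0"
    and "a * b * c + 2 * d * e * f - a * d\<^sup>2 - b * e\<^sup>2 - c * f\<^sup>2 = 1"
  shows "\<exists>u v w. tern a b c d e f x y z = u\<^sup>2 + v\<^sup>2 + w\<^sup>2"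
  using assms
proof (induction "nat (a + (a * b - f\<^sup>2))" arbitrary: a b c d e f x y z rule: less_induct)
  case less
  note a = less.prems(1) and D = less.prems(2) and det = less.prems(3)
  define D' where "D' = a * b - f\<^sup>2"
  \<comment> \<open>\<open>D'\<close>, \<open>P\<close> and \<open>B\<close> are entries of the adjoint matrix; case 1 lowers \<open>a\<close> and keeps \<open>D'\<close>,
    case 2 lowers \<open>D'\<close> and keeps \<open>a\<close>\<close>
  define B where "B = a * c - e\<^sup>2"
  define P where "P = e * f - a * d"
  \<comment> \<open>Jacobi's identity: a minor of the adjoint is the determinant, here 1, times the
    complementary entry of the form.\<close>
  have key: "B * D' - P\<^sup>2 = a"
  proof -
    have "B * D' - P\<^sup>2 = a * (a * b * c + 2 * d * e * f - a * d\<^sup>2 - b * e\<^sup>2 - c * f\<^sup>2)"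
      unfolding B_def D'_def P_def by (simp add: power2_eq_square algebra_simps)
    then show ?thesis using det by simp
  qed
  have D'0: "D' > 0" using D by (simp add: D'_def)
  have B0: "B > 0"
  proof -
    have "0 < B * D'" using key a zero_le_power2[of P] by linarith
    then show ?thesis using D'0 by (simp add: zero_less_mult_iff)
  qed
  obtain s where s: "4 * (f + s * a)\<^sup>2 \<le> a\<^sup>2" using nearest_multiple[OF a] by blast
  obtain r where r: "4 * (P + r * D')\<^sup>2 \<le> D'\<^sup>2" using nearest_multiple[OF D'0] by blast
  define b' where "b' = b + 2 * s * f + s\<^sup>2 * a"
  have b': "a * b' - (f + s * a)\<^sup>2 = D'" unfolding b'_def D'_def by (simp add: power2_eq_square algebra_simps)
  consider "b' < a" | "B + 2 * r * P + r\<^sup>2 * D' < D'"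
    | "a \<le> b'" "D' \<le> B + 2 * r * P + r\<^sup>2 * D'" by linarith
  then show ?case
  proof cases
    case 1
    have "0 < a * b'" using b' D'0 zero_le_power2[of "f + s * a"] by linarith
    then have "b' > 0" using a by (simp add: zero_less_mult_iff)
    have det': "b' * a * c + 2 * e * (d + s * e) * (f + s * a) - b' * e\<^sup>2 - a * (d + s * e)\<^sup>2 - c * (f + s * a)\<^sup>2 = 1"
      unfolding b'_def det[symmetric] by (simp add: power2_eq_square algebra_simps)
    have eq: "tern a b c d e f x y z = tern b' a c e (d + s * e) (f + s * a) y (x - s * y) z"
      unfolding tern_def b'_def by (simp add: power2_eq_square algebra_simps)
    show ?thesis unfolding eq
    proof (rule less.hyps)
      have "b' * a - (f + s * a)\<^sup>2 = D'" using b' by (simp add: mult.commute)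
      then show "nat (b' + (b' * a - (f + s * a)\<^sup>2)) < nat (a + (a * b - f\<^sup>2))" "b' * a - (f + s * a)\<^sup>2 > 0"
        using 1 D'0 a \<open>b' > 0\<close> by (auto simp: D'_def)
    qed (use \<open>b' > 0\<close> det' in auto)
  next
    case 2
    define B' where "B' = B + 2 * r * P + r\<^sup>2 * D'"
    have B': "a * (c - 2 * r * d + r\<^sup>2 * b) - (e - r * f)\<^sup>2 = B'"
      unfolding B'_def B_def P_def D'_def by (simp add: power2_eq_square algebra_simps)
    have "B' * D' - (P + r * D')\<^sup>2 = a" unfolding B'_def key[symmetric] by (simp add: power2_eq_square algebra_simps)
    then have "0 < B' * D'" using a zero_le_power2[of "P + r * D'"] by linarith
    then have "B' > 0" using D'0 by (simp add: zero_less_mult_iff)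
    have det': "a * (c - 2 * r * d + r\<^sup>2 * b) * b + 2 * (d - r * b) * f * (e - r * f) - a * (d - r * b)\<^sup>2
        - (c - 2 * r * d + r\<^sup>2 * b) * f\<^sup>2 - b * (e - r * f)\<^sup>2 = 1"
      unfolding det[symmetric] by (simp add: power2_eq_square algebra_simps)
    have eq: "tern a b c d e f x y z =
        tern a (c - 2 * r * d + r\<^sup>2 * b) b (d - r * b) f (e - r * f) x z (y + r * z)"
      unfolding tern_def by (simp add: power2_eq_square algebra_simps)
    show ?thesis unfolding eq
    proof (rule less.hyps)
      show "nat (a + (a * (c - 2 * r * d + r\<^sup>2 * b) - (e - r * f)\<^sup>2)) < nat (a + (a * b - f\<^sup>2))"
        "a * (c - 2 * r * d + r\<^sup>2 * b) - (e - r * f)\<^sup>2 > 0"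
        using 2 \<open>B' > 0\<close> D a unfolding B' by (auto simp: B'_def D'_def)
    qed (use a det' in auto)
  next
    case 3
    have "a * a \<le> a * b'" using 3(1) a by (intro mult_left_mono) auto
    then have 1: "3 * a\<^sup>2 \<le> 4 * D'" using b' s by (simp add: power2_eq_square)
    define B' where "B' = B + 2 * r * P + r\<^sup>2 * D'"
    have B': "B' * D' - (P + r * D')\<^sup>2 = a" unfolding B'_def key[symmetric] by (simp add: power2_eq_square algebra_simps)
    have "D' * D' \<le> D' * B'" using 3(2) D'0 unfolding B'_def by (intro mult_left_mono) auto
    then have 2: "3 * D'\<^sup>2 \<le> 4 * a" using B' r by (simp add: power2_eq_square mult.commute)
    \<comment> \<open>If \<open>a \<ge> 2\<close>, then \<open>D' < a\<close> contradicts the first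
      of the two inequalities and \<open>D' \<ge> a\<close> the second.\<close>
    have "a = 1 \<and> D' = 1"
    proof -
      have "a \<le> 1"
      proof (rule ccontr)
        assume "\<not> a \<le> 1"
        then have a2: "a \<ge> 2" by simp
        have "D' < a"
        proof (rule ccontr)
          assume "\<not> D' < a"
          then have "a * a \<le> D' * D'" using a by (intro mult_mono) auto
          moreover have "2 * a \<le> a * a" using a2 by (intro mult_right_mono) auto
          ultimately show False using 2 a2 unfolding power2_eq_square by linarith
        qed
        moreover have "2 * a \<le> a * a" using a2 by (intro mult_right_mono) auto
        ultimately show False using 1 a2 unfolding power2_eq_square by linarith
      qed
      then have "a = 1" using a by simp
      moreover have "D' \<le> 1"
      proof (rule ccontr)
        assume "\<not> D' \<le> 1"
        then have "2 * 2 \<le> D' * D'" by (intro mult_mono) auto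
        then show False using 2 \<open>a = 1\<close> by (simp add: power2_eq_square)
      qed
      ultimately show ?thesis using D'0 by simp
    qed
    then have a1: "a = 1" and D1: "b = f\<^sup>2 + 1" by (auto simp: D'_def)
    \<comment> \<open>The determinant condition fixes \<open>c\<close>; completing squares then
      gives an integral substitution with determinant 1.\<close>
    have c: "c = e\<^sup>2 + (d - e * f)\<^sup>2 + 1"
      using det unfolding a1 D1 by (simp add: power2_eq_square algebra_simps)
    have "tern a b c d e f x y z = (x + f * y + e * z)\<^sup>2 + (y + (d - e * f) * z)\<^sup>2 + z\<^sup>2"
      unfolding tern_def a1 D1 c by (simp add: power2_eq_square algebra_simps)
    then show ?thesis by blast
  qed
qed

text \<open>The form \<open>tern (q * k) l n (t * b) (t * q) (b * k)\<close> takes the value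
  \<open>n\<close> at (0, 0, 1). Its determinant factors as
  \<open>(n * k - t^2 * q) * (q * l - b^2 * k)\<close>, and the divisibility conditions make both
  factors 1.\<close>

lemma three_squares_criterion:
  fixes n q :: int
  assumes n: "n > 0" and q: "q > 0" "coprime q n"
    and t: "n dvd t\<^sup>2 * q + 1" and b: "q dvd b\<^sup>2 + n"
  shows "\<exists>x y z. n = x\<^sup>2 + y\<^sup>2 + z\<^sup>2"
proof -
  obtain h where h: "b\<^sup>2 + n = q * h" using b by blast
  obtain k where k: "t\<^sup>2 * q + 1 = n * k" using t by blast
  have "n dvd q * (t\<^sup>2 * b\<^sup>2 + h)"
  proof
    have "q * (t\<^sup>2 * b\<^sup>2 + h) = b\<^sup>2 * (t\<^sup>2 * q + 1) + n"
      using h by (simp add: algebra_simps)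
    then show "q * (t\<^sup>2 * b\<^sup>2 + h) = n * (b\<^sup>2 * k + 1)"
      unfolding k by (simp add: algebra_simps)
  qed
  then have "n dvd t\<^sup>2 * b\<^sup>2 + h"
    using q(2) by (simp add: coprime_dvd_mult_right_iff coprime_commute)
  then obtain l where l: "t\<^sup>2 * b\<^sup>2 + h = n * l" by blast
  have "n * (q * l - b\<^sup>2 * k) = q * (n * l) - b\<^sup>2 * (n * k)" by (simp add: algebra_simps)
  also have "\<dots> = q * h - b\<^sup>2" unfolding l[symmetric] k[symmetric] by (simp add: algebra_simps)
  also have "\<dots> = n * 1" using h by simp
  finally have m1: "q * l - b\<^sup>2 * k = 1" using n by simp
  have k0: "k > 0"
  proof -
    have "0 < n * k" unfolding k[symmetric] using q zero_le_power2[of t] by (simp add: add_nonneg_pos)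
    then show ?thesis using n by (simp add: zero_less_mult_iff)
  qed
  have "\<exists>u v w. tern (q * k) l n (t * b) (t * q) (b * k) 0 0 1 = u\<^sup>2 + v\<^sup>2 + w\<^sup>2"
  proof (rule tern_one_sum_three_squares)
    show "q * k > 0" using q k0 by simp
    have "q * k * l - (b * k)\<^sup>2 = k * (q * l - b\<^sup>2 * k)"
      by (simp add: power2_eq_square algebra_simps)
    then show minor: "q * k * l - (b * k)\<^sup>2 > 0" using m1 k0 by simp
    have "q * k * l * n + 2 * (t * b) * (t * q) * (b * k) - q * k * (t * b)\<^sup>2 - l * (t * q)\<^sup>2 - n * (b * k)\<^sup>2
        = (n * k - t\<^sup>2 * q) * (q * l - b\<^sup>2 * k)"
      by (simp add: power2_eq_square algebra_simps)
    also have "\<dots> = 1" using m1 k by simp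
    finally show "q * k * l * n + 2 * (t * b) * (t * q) * (b * k) - q * k * (t * b)\<^sup>2 - l * (t * q)\<^sup>2 - n * (b * k)\<^sup>2 = 1" .
  qed
  then show ?thesis by (simp add: tern_def)
qed

section \<open>Legendre symbols of -1 and 2, and the theorem of three squares\<close>

lemma Legendre_minus_1:
  fixes p :: nat
  assumes p: "prime p" "2 < p"
  shows "Legendre (-1) p = (if p mod 4 = 1 then 1 else -1)"
proof (rule cong_small_eq)
  have "odd p" using p prime_odd_nat by blast
  then have "even ((p - 1) div 2) \<longleftrightarrow> p mod 4 = 1" by presburger
  then have e: "(-1 :: int) ^ ((p - 1) div 2) = (if p mod 4 = 1 then 1 else -1)" by simp
  show "[Legendre (-1) p = (if p mod 4 = 1 then 1 else -1)] (mod p)"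
    using euler_criterion[OF p, of "-1"] unfolding e .
  show "\<bar>Legendre (-1) p - (if p mod 4 = 1 then 1 else -1)\<bar> < int p"
    using Legendre_range[of "-1" p] p(2) by auto
qed

text \<open>If \<open>i\<close> is a square root of -1 modulo \<open>q\<close>, then \<open>(1 + i)\<^sup>2\<close> is \<open>2 i\<close>, so 2 and \<open>i\<close> have the same
  quadratic character.\<close>
lemma Legendre_2:
  fixes q :: nat
  assumes q: "prime q" "q mod 8 \<in> {1, 5}"
  shows "Legendre 2 q = (if q mod 8 = 1 then 1 else -1)"
proof -
  have q2: "2 < q"
  proof -
    have "q \<noteq> 2" using q(2) by auto
    then show ?thesis using prime_ge_2_nat[OF q(1)] by linarith
  qed
  have "q mod 4 = 1" using q(2) unfolding insert_iff empty_iff by presburger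
  then have "Legendre (-1) q = 1" using Legendre_minus_1[OF q(1) q2] by simp
  then obtain i where i: "[i\<^sup>2 = -1] (mod int q)"
    by (auto simp: Legendre_def QuadRes_def split: if_splits)
  have i2: "int q dvd i\<^sup>2 + 1" using i by (simp add: cong_iff_dvd_diff)
  have "\<not> int q dvd 1 + i"
  proof
    assume "int q dvd 1 + i"
    then have "int q dvd (1 + i) * (i - 1)" by (rule dvd_mult2)
    then have "int q dvd i\<^sup>2 + 1 - (1 + i) * (i - 1)" by (rule dvd_diff[OF i2])
    then have "int q dvd 2" by (simp add: power2_eq_square algebra_simps)
    then show False using q2 zdvd_imp_le by force
  qed
  then have L1: "Legendre (1 + i) q * Legendre (1 + i) q = 1"
    by (auto simp: Legendre_def cong_0_iff)
  have "[2 * i = (1 + i) * (1 + i)] (mod int q)"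
    using i2 unfolding cong_iff_dvd_diff
    by (subst dvd_diff_commute) (simp add: power2_eq_square algebra_simps)
  then have "Legendre (2 * i) q = Legendre ((1 + i) * (1 + i)) q" by (rule Legendre_cong)
  then have 2: "Legendre 2 q * Legendre i q = 1"
    unfolding Legendre_mult[OF q(1) q2] L1 .
  have "Legendre i q = (if q mod 8 = 1 then 1 else -1)"
  proof (rule cong_small_eq)
    define k where "k = q div 8"
    have e: "(q - 1) div 2 = (if q mod 8 = 1 then 2 * (2 * k) else 2 * (2 * k + 1))"
      using q(2) unfolding k_def insert_iff empty_iff by presburger
    have "i ^ ((q - 1) div 2) = (i\<^sup>2) ^ (if q mod 8 = 1 then 2 * k else 2 * k + 1)"
      unfolding e by (cases "q mod 8 = 1") (simp_all only: if_True if_False power_mult simp_thms)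
    moreover have "[(i\<^sup>2) ^ (if q mod 8 = 1 then 2 * k else 2 * k + 1) = (-1) ^ (if q mod 8 = 1 then 2 * k else 2 * k + 1)] (mod int q)"
      by (rule cong_pow[OF i])
    ultimately show "[Legendre i q = (if q mod 8 = 1 then 1 else -1)] (mod int q)"
      using cong_trans[OF euler_criterion[OF q(1) q2, of i]] by (simp split: if_splits)
    show "\<bar>Legendre i q - (if q mod 8 = 1 then 1 else -1)\<bar> < int q"
      using Legendre_range[of i q] q2 by auto
  qed
  then show ?thesis using 2 by (auto split: if_splits)
qed

lemma Legendre_minus_1_prod:
  fixes P :: "nat set"
  assumes "finite P" "\<And>p. p \<in> P \<Longrightarrow> prime p \<and> 2 < p"
  shows "odd (\<Prod>P) \<and> (\<Prod>p\<in>P. Legendre (-1) p) = (if \<Prod>P mod 4 = 1 then 1 else -1)"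
  using assms
proof (induction P rule: finite_induct)
  case (insert p P)
  have p: "prime p" "2 < p" using insert.prems by auto
  have IH: "odd (\<Prod>P)" "(\<Prod>p\<in>P. Legendre (-1) p) = (if \<Prod>P mod 4 = 1 then 1 else -1)"
    using insert by auto
  have "odd p" using p prime_odd_nat by blast
  then have c: "p mod 4 = 1 \<or> p mod 4 = 3" "\<Prod>P mod 4 = 1 \<or> \<Prod>P mod 4 = 3" using IH(1) by presburger+
  have "p * \<Prod>P mod 4 = (p mod 4) * (\<Prod>P mod 4) mod 4" by (simp only: mod_mult_eq)
  then have "p * \<Prod>P mod 4 = 1 \<longleftrightarrow> (p mod 4 = 1 \<longleftrightarrow> \<Prod>P mod 4 = 1)" using c by auto
  then show ?case
    using insert.hyps IH \<open>odd p\<close> by (simp add: Legendre_minus_1[OF p])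
qed simp

text \<open>The prime \<open>q\<close> is chosen to make \<open>-q\<close> a square modulo each odd
  prime factor of \<open>n\<close>. As \<open>q\<close> is 1 modulo 4, reciprocity evaluates the
  symbol of \<open>n\<close> modulo \<open>q\<close>, and the choice modulo 8 makes it 1, so that
  \<open>three_squares_criterion\<close> applies.\<close>

lemma three_squares_squarefree:
  fixes n :: nat
  assumes "squarefree n" and n4: "n mod 4 \<in> {1, 2}"
  shows "\<exists>x y z :: int. int n = x\<^sup>2 + y\<^sup>2 + z\<^sup>2"
proof -
  have n0: "n > 0" using n4 by (auto intro: Nat.gr0I)
  define P where "P = prime_factors n - {2}"
  define n' where "n' = \<Prod>P"
  have P: "finite P" "prime p \<and> 2 < p" if "p \<in> P" for p
    using that prime_ge_2_nat[of p] by (auto simp: P_def in_prime_factors_iff le_neq_trans)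
  have fin: "finite P" by (simp add: P_def)
  have "n = (\<Prod>p\<in>prime_factors n. p ^ multiplicity p n)"
    using n0 by (simp add: prod_prime_factors)
  also have "\<dots> = \<Prod>(prime_factors n)"
  proof (intro prod.cong refl)
    fix p assume p: "p \<in> prime_factors n"
    then have "multiplicity p n = 1"
      using assms(1) n0 squarefree_factorial_semiring'[of n] by simp
    then show "p ^ multiplicity p n = p" by simp
  qed
  finally have n_prod: "n = \<Prod>(prime_factors n)" .
  have n': "n = (if even n then 2 * n' else n')"
  proof (cases "even n")
    case True
    then have "2 \<in> prime_factors n" using n0 by (simp add: in_prime_factors_iff)
    then show ?thesis using True n_prod by (simp add: n'_def P_def prod.remove)
  next
    case False
    then have "P = prime_factors n" by (auto simp: P_def in_prime_factors_iff)
    then show ?thesis using False n_prod by (simp add: n'_def)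
  qed
  \<comment> \<open>For \<open>n = 2 * n'\<close> with \<open>n'\<close> congruent to 3 modulo 4,
    the symbol of \<open>n'\<close> modulo \<open>q\<close> is -1; the residue 5 makes the symbol of
    2 equal to -1 as well.\<close>
  define r where "r = (if even n \<and> n' mod 4 = 3 then 5 else 1 :: nat)"
  have sign: "odd n'" "(\<Prod>p\<in>P. Legendre (-1) p) = (if n' mod 4 = 1 then 1 else -1)"
    using Legendre_minus_1_prod[OF fin P(2)] by (auto simp: n'_def)
  have "\<exists>q::nat. prime q \<and> q > n \<and> q mod 8 = r \<and> (\<forall>p\<in>P. Legendre q p = Legendre (-1) p)"
  proof (rule prime_with_Legendre_values[OF fin])
    show "Legendre (-1) p \<in> {-1, 1}" if "p \<in> P" for p
      using P(2)[OF that] Legendre_minus_1[of p] by auto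
  qed (use P(2) in \<open>auto simp: r_def\<close>)
  then obtain q :: nat where q: "prime q" "q > n" "q mod 8 = r"
    "\<And>p. p \<in> P \<Longrightarrow> Legendre q p = Legendre (-1) p" by blast
  have q4: "q mod 4 = 1" using q(3) unfolding r_def by (simp split: if_splits) presburger+
  have q2: "2 < q"
  proof -
    have "q \<noteq> 2" using q4 by auto
    then show ?thesis using prime_ge_2_nat[OF q(1)] by linarith
  qed
  have "\<not> q dvd n" using q(2) n0 dvd_imp_le by fastforce
  then have "coprime q n" using q(1) by (rule prime_imp_coprime[rotated])
  have sq: "\<exists>s::nat. [s\<^sup>2 + q = 0] (mod p)" if p: "p \<in> prime_factors n" for p
  proof (cases "p = 2")
    case True
    then show ?thesis using q4 by (intro exI[of _ 1]) (simp add: cong_0_iff, presburger)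
  next
    case False
    then have pP: "p \<in> P" using p by (simp add: P_def)
    have "Legendre (-1 * q) p = 1"
      using q(4)[OF pP] P(2)[OF pP] Legendre_minus_1[of p] by (subst Legendre_mult) auto
    then obtain s where s: "[s\<^sup>2 = - int q] (mod int p)"
      by (auto simp: Legendre_def QuadRes_def split: if_splits)
    define z where "z = nat (s mod int p)"
    have "int z = s mod int p" using P(2)[OF pP] by (simp add: z_def)
    then have "[(int z)\<^sup>2 = s\<^sup>2] (mod int p)" by (simp add: cong_def power_mod)
    then have "[(int z)\<^sup>2 = - int q] (mod int p)" using s by (rule cong_trans)
    then have "int p dvd int (z\<^sup>2 + q)" by (simp add: cong_iff_dvd_diff)
    then show ?thesis by (auto simp: cong_0_iff simp del: of_nat_add)
  qed
  then obtain S where S: "\<And>p. p \<in> prime_factors n \<Longrightarrow> [(S p)\<^sup>2 + q = 0] (mod p)" by metis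
  have cop: "\<forall>i\<in>prime_factors n. \<forall>j\<in>prime_factors n. i \<noteq> j \<longrightarrow> coprime (id i) (id j)"
    by (auto simp: in_prime_factors_iff primes_coprime)
  obtain s where s: "\<And>p. p \<in> prime_factors n \<Longrightarrow> [s = S p] (mod p)"
    using chinese_remainder_nat[OF _ cop, of S] by auto
  have "[s\<^sup>2 + q = 0] (mod p)" if "p \<in> prime_factors n" for p
    using S[OF that] s[OF that] by (meson cong_add cong_pow cong_refl cong_trans)
  then have "[s\<^sup>2 + q = 0] (mod (\<Prod>p\<in>prime_factors n. id p))"
    using cop by (intro coprime_cong_prod_nat) auto
  then have s_dvd: "int n dvd (int s)\<^sup>2 + int q"
    using n_prod by (simp add: cong_0_iff flip: of_nat_power of_nat_add)
  have "coprime (int q) (int n)" using \<open>coprime q n\<close> by simp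
  then obtain w where w: "[int q * w = 1] (mod int n)" using cong_solve_coprime_int by blast
  have w2: "int n dvd (int q * w)\<^sup>2 - 1\<^sup>2"
    using cong_pow[OF w, of 2] by (simp only: cong_iff_dvd_diff)
  \<comment> \<open>\<open>w\<close> inverts \<open>q\<close> modulo \<open>n\<close>, so
    \<open>s^2 = -q\<close> turns into \<open>(s * w)^2 * q = -1\<close> modulo
    \<open>n\<close>.\<close>
  have "(int s * w)\<^sup>2 * int q + 1 = w\<^sup>2 * int q * ((int s)\<^sup>2 + int q) - ((int q * w)\<^sup>2 - 1\<^sup>2)"
    by (simp add: power2_eq_square algebra_simps)
  then have t: "int n dvd (int s * w)\<^sup>2 * int q + 1"
    using s_dvd w2 by (metis dvd_diff dvd_mult)
  have Lp: "Legendre p q = Legendre (-1) p" if "p \<in> P" for p :: nat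
  proof -
    have "p \<le> n" using that n0 by (auto simp: P_def in_prime_factors_iff dvd_imp_le)
    then have "p \<noteq> q" using q(2) by auto
    then have "Legendre p q * Legendre q p = (-1) ^ ((p - 1) div 2 * ((q - 1) div 2))"
      using P(2)[OF that] q(1) q2 by (intro Quadratic_Reciprocity) auto
    moreover have "even ((q - 1) div 2)" using q4 by presburger
    ultimately have "Legendre p q * Legendre q p = 1" by simp
    then show ?thesis using q(4)[OF that] Legendre_range[of p q] Legendre_range[of q p] by auto
  qed
  have "Legendre (int n') q = (\<Prod>p\<in>P. Legendre (int p) q)"
    unfolding n'_def using fin
    by (induction P rule: finite_induct) (use q(1) q2 in \<open>auto simp: Legendre_mult Legendre_1\<close>)
  also have "\<dots> = (if n' mod 4 = 1 then 1 else -1)"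
    using Lp sign(2) by simp
  finally have Ln': "Legendre (int n') q = (if n' mod 4 = 1 then 1 else -1)" .
  have "Legendre (int n) q = 1"
  proof (cases "even n")
    case True
    then have "int n = 2 * int n'" using n' by presburger
    moreover have "Legendre 2 q = (if r = 1 then 1 else -1)"
      using Legendre_2[OF q(1)] q(3) by (auto simp: r_def)
    moreover have "n' mod 4 = 1 \<or> n' mod 4 = 3" using sign(1) by presburger
    ultimately show ?thesis
      using True Ln' by (auto simp: Legendre_mult[OF q(1) q2] r_def)
  next
    case False
    then have "n = n'" using n' by simp
    moreover have "n mod 4 = 1" using False n4 by auto presburger
    ultimately show ?thesis using Ln' by simp
  qed
  then have "Legendre (-1 * int n) q = 1"
    unfolding Legendre_mult[OF q(1) q2] using Legendre_minus_1[OF q(1) q2] q4 by simp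
  then obtain b where "[b\<^sup>2 = - int n] (mod int q)"
    by (auto simp: Legendre_def QuadRes_def split: if_splits)
  then have b: "int q dvd b\<^sup>2 + int n" by (simp add: cong_iff_dvd_diff)
  show ?thesis
    using three_squares_criterion[OF _ _ \<open>coprime (int q) (int n)\<close> t b] n0 prime_gt_0_nat[OF q(1)] by simp
qed

text \<open>A square divisor \<open>k^2\<close> of \<open>n\<close> has odd \<open>k\<close>, since
  4 does not divide \<open>n\<close>; hence the cofactor keeps its residue modulo 4, and its
  representation is scaled by \<open>k\<close>.\<close>

theorem three_squares:
  fixes n :: nat
  assumes "n mod 4 \<in> {1, 2}"
  shows "\<exists>x y z :: int. int n = x\<^sup>2 + y\<^sup>2 + z\<^sup>2"
  using assms
proof (induction n rule: less_induct)
  case (less n)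
  show ?case
  proof (cases "squarefree n")
    case True
    then show ?thesis using three_squares_squarefree less.prems by blast
  next
    case False
    then obtain k where k: "k\<^sup>2 dvd n" "k \<noteq> 1" by (auto simp: squarefree_def)
    then obtain l where l: "n = k\<^sup>2 * l" by blast
    have "odd k"
    proof
      assume "even k"
      then have "4 dvd k\<^sup>2" by (auto simp: power2_eq_square elim!: evenE)
      then have "4 dvd n" using k(1) dvd_trans by blast
      then show False using less.prems by auto
    qed
    then obtain j where j: "k = 2 * j + 1" by (elim oddE)
    then have "n = 4 * (l * (j * j + j)) + l" by (simp add: l power2_eq_square algebra_simps)
    moreover have "j > 0" using j k(2) by simp
    moreover have "l > 0" using l less.prems by (auto intro: Nat.gr0I)
    ultimately have "l < n" "l mod 4 = n mod 4" by simp_all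
    then obtain x y z :: int where xyz: "int l = x\<^sup>2 + y\<^sup>2 + z\<^sup>2"
      using less.IH[of l] less.prems by auto
    have "int n = int l * (int k)\<^sup>2" by (simp add: l mult.commute)
    then have "int n = (x * int k)\<^sup>2 + (y * int k)\<^sup>2 + (z * int k)\<^sup>2"
      unfolding xyz by (simp add: power_mult_distrib distrib_right)
    then show ?thesis by blast
  qed
qed

section \<open>Two diagonal ternary forms\<close>

lemma three_squares_int:
  fixes n :: int
  assumes "n > 0" "n mod 4 \<in> {1, 2}"
  shows "\<exists>x y z. n = x\<^sup>2 + y\<^sup>2 + z\<^sup>2"
proof -
  have n: "int (nat n) = n" using assms(1) by simp
  have "int (nat n mod 4) \<in> {1, 2}" using assms(2) n by (simp only: zmod_int of_nat_numeral)
  then have "nat n mod 4 \<in> {1, 2}" by auto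
  from three_squares[OF this] show ?thesis using n by simp
qed

lemma mod_linear:
  fixes m :: int
  shows "(a * x + b * y + c * z) mod m = (a * (x mod m) + b * (y mod m) + c * (z mod m)) mod m"
proof -
  have "[a * x + b * y + c * z = a * (x mod m) + b * (y mod m) + c * (z mod m)] (mod m)"
    by (intro cong_add cong_mult cong_refl) (simp_all add: cong_def)
  then show ?thesis by (simp only: cong_def)
qed

lemma square_mod_3: "x\<^sup>2 mod 3 = (if 3 dvd x then 0 else 1 :: int)"
proof -
  consider k where "x = 3 * k" | k where "x = 3 * k + 1" | k where "x = 3 * k + 2"
  proof -
    have "x = 3 * (x div 3) \<or> x = 3 * (x div 3) + 1 \<or> x = 3 * (x div 3) + 2" by presburger
    then show ?thesis using that by blast
  qed
  then show ?thesis
  proof cases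
    case 1
    then show ?thesis by (simp add: power2_eq_square)
  next
    case 2
    then have "x\<^sup>2 = 3 * (3 * k * k + 2 * k) + 1" by (simp add: power2_eq_square algebra_simps)
    then have "x\<^sup>2 mod 3 = 1" by presburger
    moreover have "\<not> 3 dvd x" using 2 by presburger
    ultimately show ?thesis by simp
  next
    case 3
    then have "x\<^sup>2 = 3 * (3 * k * k + 4 * k + 1) + 1" by (simp add: power2_eq_square algebra_simps)
    then have "x\<^sup>2 mod 3 = 1" by presburger
    moreover have "\<not> 3 dvd x" using 3 by presburger
    ultimately show ?thesis by simp
  qed
qed

lemma square_even_mod_8: "even x \<Longrightarrow> x\<^sup>2 mod 8 = 0 \<or> x\<^sup>2 mod 8 = (4 :: int)"
proof (elim evenE)
  fix k assume x: "x = 2 * k"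
  show ?thesis
  proof (cases "even k")
    case True
    then obtain j where "k = 2 * j" by blast
    then have "x\<^sup>2 = 8 * (2 * j * j)" by (simp add: x power2_eq_square)
    then show ?thesis by simp
  next
    case False
    then obtain j where "k = 2 * j + 1" by (elim oddE)
    then have "x\<^sup>2 = 4 + 8 * (2 * j * j + 2 * j)" by (simp add: x power2_eq_square algebra_simps)
    then have "x\<^sup>2 mod 8 = 4 mod 8" by (simp only: mod_mult_self2)
    then show ?thesis by simp
  qed
qed

lemma square_odd_mod_8: "odd x \<Longrightarrow> x\<^sup>2 mod 8 = (1 :: int)"
proof (elim oddE)
  fix k assume x: "x = 2 * k + 1"
  have "even (k * (k + 1))" by simp
  then obtain l where l: "k * (k + 1) = 2 * l" by blast
  have "x\<^sup>2 = 1 + 4 * (k * (k + 1))" by (simp add: x power2_eq_square algebra_simps)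
  also have "\<dots> = 1 + 8 * l" unfolding l by simp
  finally show ?thesis by simp
qed

text \<open>The vectors (1,-1,0), (1,1,1), (1,1,-2) are orthogonal of norms 2, 3, 6; the sublattice of
  \<open>\<int>\<^sup>3\<close> which they span is cut out by a congruence modulo 2 and one modulo 3.\<close>
lemma form_2_3_6:
  fixes n :: int
  assumes "n > 0" "n mod 8 = 1" "n mod 3 \<noteq> 1"
  shows "\<exists>x y z. n = 2 * x\<^sup>2 + 3 * y\<^sup>2 + 6 * z\<^sup>2"
proof -
  have "n mod 4 = 1" using assms(2) by presburger
  then obtain a b c where abc: "n = a\<^sup>2 + b\<^sup>2 + c\<^sup>2" using three_squares_int[of n] assms(1) by auto
  define good where "good a b c \<longleftrightarrow> n = a\<^sup>2 + b\<^sup>2 + c\<^sup>2 \<and> 3 dvd a + b + c" for a b c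
  have mod3: "n mod 3 = ((if 3 dvd a then 0 else 1) + (if 3 dvd b then 0 else 1) + (if 3 dvd c then 0 else 1)) mod 3"
  proof -
    have "n mod 3 = (a\<^sup>2 mod 3 + b\<^sup>2 mod 3 + c\<^sup>2 mod 3) mod 3"
      using mod_linear[of 1 "a\<^sup>2" 1 "b\<^sup>2" 1 "c\<^sup>2" 3] by (simp only: abc mult_1)
    then show ?thesis unfolding square_mod_3 .
  qed
  \<comment> \<open>As \<open>n\<close> is not 1 modulo 3, the number of entries prime to 3 is not
    1, so signs can be chosen to make the sum divisible by 3. For the condition modulo 2, two of
    three integers always have equal parity.\<close>
  have "3 dvd a + b + c \<or> 3 dvd a + b - c \<or> 3 dvd a - b + c \<or> 3 dvd a - b - c"
    using mod3 assms(3) by (simp split: if_splits) presburger+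
  then have "good a b c \<or> good a b (- c) \<or> good a (- b) c \<or> good a (- b) (- c)"
    by (auto simp: good_def abc)
  then obtain a b c where abc: "good a b c" by blast
  then have perm: "good a c b" "good b c a" by (auto simp: good_def algebra_simps)
  have "even (a - b) \<or> even (a - c) \<or> even (b - c)" by presburger
  with abc perm obtain a b c where abc: "good a b c" and par: "even (a - b)" by blast
  obtain x where "a - b = 2 * x" using par by blast
  then have x: "a = b + 2 * x" by simp
  obtain y where y: "a + b + c = 3 * y" using abc by (auto simp: good_def)
  define z where "z = b + x - y"
  have eqs: "a = x + y + z" "b = y + z - x" "c = y - 2 * z" using x y by (auto simp: z_def)
  have "n = a\<^sup>2 + b\<^sup>2 + c\<^sup>2" using abc by (simp add: good_def)
  then have "n = 2 * x\<^sup>2 + 3 * y\<^sup>2 + 6 * z\<^sup>2"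
    unfolding eqs by (simp add: power2_eq_square algebra_simps)
  then show ?thesis by blast
qed

text \<open>Since 3 is the norm of \<open>1 + sqrt(-2)\<close>, after a sign change of
  \<open>y\<close> the number \<open>x + y * sqrt(-2)\<close> is divisible by that element.\<close>

lemma divide_by_sqrt_minus_2:
  fixes x y :: int
  assumes "3 dvd x\<^sup>2 + 2 * y\<^sup>2"
  shows "\<exists>u v. x\<^sup>2 + 2 * y\<^sup>2 = 3 * (u\<^sup>2 + 2 * v\<^sup>2)"
proof -
  have "(x\<^sup>2 mod 3 + 2 * (y\<^sup>2 mod 3)) mod 3 = 0" 
    using mod_linear[of 1 "x\<^sup>2" 2 "y\<^sup>2" 0 0 3] assms by simp
  then have "3 dvd x \<longleftrightarrow> 3 dvd y" unfolding square_mod_3 by (simp split: if_splits)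
  then have "3 dvd y - x \<or> 3 dvd - y - x" by presburger
  then obtain w where "w = y \<or> w = - y" and dvd: "3 dvd w - x" by blast
  then have w: "w\<^sup>2 = y\<^sup>2" by auto
  obtain v where "w - x = 3 * v" using dvd by blast
  then have v: "w = x + 3 * v" by simp
  have "x\<^sup>2 + 2 * w\<^sup>2 = 3 * ((x + 2 * v)\<^sup>2 + 2 * v\<^sup>2)"
    unfolding v by (simp add: power2_eq_square algebra_simps)
  then show ?thesis using w by auto
qed

text \<open>Factors 9 common to both squares are removed until \<open>u\<close> and \<open>v\<close>
  are not both divisible by 3. A factor 9 is restored by multiplying with one of
  \<open>1 + 2 * sqrt(-2)\<close> and \<open>1 - 2 * sqrt(-2)\<close>, of norm 9; at least one
  choice leaves a first entry prime to 3.\<close>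

lemma not_dvd_3_representation:
  fixes x y :: int
  assumes "3 dvd x\<^sup>2 + 2 * y\<^sup>2" "x\<^sup>2 + 2 * y\<^sup>2 > 0"
  shows "\<exists>u v. x\<^sup>2 + 2 * y\<^sup>2 = u\<^sup>2 + 2 * v\<^sup>2 \<and> \<not> 3 dvd u"
  using assms
proof (induction "nat (x\<^sup>2 + 2 * y\<^sup>2)" arbitrary: x y rule: less_induct)
  case less
  show ?case
  proof (cases "3 dvd x")
    case True
    have "(x\<^sup>2 mod 3 + 2 * (y\<^sup>2 mod 3)) mod 3 = 0" 
      using mod_linear[of 1 "x\<^sup>2" 2 "y\<^sup>2" 0 0 3] less.prems(1) by simp
    then have "3 dvd y" using True unfolding square_mod_3 by (simp split: if_splits)
    with True obtain x' y' where xy: "x = 3 * x'" "y = 3 * y'" by blast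
    then have n: "x\<^sup>2 + 2 * y\<^sup>2 = 9 * (x'\<^sup>2 + 2 * y'\<^sup>2)" by (simp add: power_mult_distrib)
    have "\<exists>u v. x'\<^sup>2 + 2 * y'\<^sup>2 = u\<^sup>2 + 2 * v\<^sup>2 \<and> \<not> (3 dvd u \<and> 3 dvd v)"
    proof (cases "3 dvd x'\<^sup>2 + 2 * y'\<^sup>2")
      case True
      have "nat N < nat M \<and> 0 < N" if "M = 9 * N" "0 < M" for M N :: int
        using that by auto
      from this[OF n less.prems(2)]
      have "nat (x'\<^sup>2 + 2 * y'\<^sup>2) < nat (x\<^sup>2 + 2 * y\<^sup>2)" "0 < x'\<^sup>2 + 2 * y'\<^sup>2" by auto
      then show ?thesis using less.hyps True by blast
    next
      case False
      then have "\<not> (3 dvd x' \<and> 3 dvd y')" by (auto simp: power2_eq_square)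
      then show ?thesis by blast
    qed
    then obtain u v where uv: "x'\<^sup>2 + 2 * y'\<^sup>2 = u\<^sup>2 + 2 * v\<^sup>2" "\<not> (3 dvd u \<and> 3 dvd v)" by blast
    then have "\<not> 3 dvd u + 4 * v \<or> \<not> 3 dvd u - 4 * v" by presburger
    moreover have "x\<^sup>2 + 2 * y\<^sup>2 = (u + 4 * v)\<^sup>2 + 2 * (2 * u - v)\<^sup>2" "x\<^sup>2 + 2 * y\<^sup>2 = (u - 4 * v)\<^sup>2 + 2 * (2 * u + v)\<^sup>2"
      unfolding n uv(1) by (simp_all add: power2_eq_square algebra_simps)
    ultimately show ?thesis by blast
  qed auto
qed

text \<open>Three squares for \<open>2 * n\<close> give \<open>n = x^2 + y^2 + 2 * d^2\<close> with
  even \<open>y = 2 * z\<close>. Once 3 divides \<open>y^2 + 2 * d^2 = 2 * (d^2 + 2 * z^2)\<close>,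
  a division in \<open>Z[sqrt(-2)]\<close> turns this part into \<open>6 * u^2 + 12 * v^2\<close>.
  The two cases arrange that divisibility.\<close>

lemma form_1_6_12:
  fixes n :: int
  assumes "n > 0" "odd n" "n mod 3 = 1 \<or> 9 dvd n"
  shows "\<exists>x y z. n = x\<^sup>2 + 6 * y\<^sup>2 + 12 * z\<^sup>2"
proof -
  have "2 * n mod 4 = 2" using assms(2) by presburger
  then obtain a b c where "2 * n = a\<^sup>2 + b\<^sup>2 + c\<^sup>2" using three_squares_int[of "2 * n"] assms(1) by auto
  note sum = this
  then have "even (a\<^sup>2 + b\<^sup>2 + c\<^sup>2)" by (metis dvd_triv_left)
  then have "even (a + b + c)" by simp
  then have "even (a - b) \<and> even c \<or> even (a - c) \<and> even b \<or> even (b - c) \<and> even a" by presburger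
  moreover have "2 * n = a\<^sup>2 + c\<^sup>2 + b\<^sup>2" "2 * n = b\<^sup>2 + c\<^sup>2 + a\<^sup>2" using sum by simp_all
  ultimately obtain a b c where abc: "2 * n = a\<^sup>2 + b\<^sup>2 + c\<^sup>2" and par: "even (a - b)" "even c"
    using sum by blast
  obtain d where d: "c = 2 * d" using par(2) by blast
  obtain s where "a - b = 2 * s" using par(1) by blast
  then have s: "a = b + 2 * s" by simp
  have n: "n = s\<^sup>2 + (b + s)\<^sup>2 + 2 * d\<^sup>2" using abc unfolding d s by (simp add: power2_eq_square algebra_simps)
  obtain x y where xy: "n = x\<^sup>2 + y\<^sup>2 + 2 * d\<^sup>2" "even y"
  proof (cases "even s")
    case True
    then show ?thesis using n that[of "b + s" s] by simp
  next
    case False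
    then have "even (b + s)" using n assms(2) by auto
    then show ?thesis using n that[of s "b + s"] by simp
  qed
  have sq: "x\<^sup>2 mod 3 = 0 \<longleftrightarrow> 3 dvd x" "x\<^sup>2 mod 3 = 0 \<or> x\<^sup>2 mod 3 = 1" for x :: int
    by (simp_all add: square_mod_3)
  have n3: "n mod 3 = (x\<^sup>2 mod 3 + y\<^sup>2 mod 3 + 2 * (d\<^sup>2 mod 3)) mod 3"
  proof -
    show ?thesis
      using mod_linear[of 1 "x\<^sup>2" 1 "y\<^sup>2" 2 "d\<^sup>2" 3] unfolding xy(1) by (simp only: mult_1)
  qed
  have "\<exists>x d. n = x\<^sup>2 + y\<^sup>2 + 2 * d\<^sup>2 \<and> 3 dvd y\<^sup>2 + 2 * d\<^sup>2"
  proof (cases "n mod 3 = 1")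
    case n1: True
    have lin: "3 dvd Y + 2 * D" if "X mod 3 = 1" "n = X + Y + 2 * D" for X Y D
    proof -
      have "3 dvd n - X" using that(1) n1 by (simp add: mod_eq_dvd_iff[symmetric])
      then show ?thesis using that(2) by simp
    qed
    show ?thesis
    proof (cases "3 dvd x")
      case False
      then show ?thesis using lin[OF _ xy(1)] sq[of x] xy(1) by blast
    next
      case True
      have "odd x" using xy assms(2) by auto
      then have "x \<noteq> 0" by auto
      then have pos: "0 < x\<^sup>2 + 2 * d\<^sup>2" by (simp add: add_pos_nonneg)
      have x0: "x\<^sup>2 mod 3 = 0" using True by (simp add: square_mod_3)
      have e: "(0 + y\<^sup>2 mod 3 + 2 * (d\<^sup>2 mod 3)) mod 3 = 1"
        using n3 unfolding n1 x0 by (rule sym)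
      \<comment> \<open>With \<open>n\<close> congruent to 1 and 3 dividing \<open>x\<close>, only
        \<open>d\<close> divisible by 3 is possible; then \<open>(x, d)\<close> can be exchanged for
        a pair whose first entry is prime to 3.\<close>
      have "D = 0" if "(0 + Y + 2 * D) mod 3 = 1" "Y = 0 \<or> Y = 1" "D = 0 \<or> D = 1" for Y D :: int
        using that by auto
      from this[OF e sq(2) sq(2)] have "d\<^sup>2 mod 3 = 0" .
      then have "3 dvd d" by (simp only: sq(1))
      with True have "3 dvd x\<^sup>2 + 2 * d\<^sup>2" by (auto simp: power2_eq_square)
      from not_dvd_3_representation[OF this pos] obtain u v where uv:
        "x\<^sup>2 + 2 * d\<^sup>2 = u\<^sup>2 + 2 * v\<^sup>2" "\<not> 3 dvd u" by blast
      then have "n = u\<^sup>2 + y\<^sup>2 + 2 * v\<^sup>2" using xy(1) by simp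
      moreover from lin[OF _ this] have "3 dvd y\<^sup>2 + 2 * v\<^sup>2" using uv(2) sq[of u] by blast
      ultimately show ?thesis by blast
    qed
  next
    case False
    then have n9: "9 dvd n" using assms(3) by blast
    then have n0: "3 dvd n" by presburger
    show ?thesis
    proof (cases "3 dvd x")
      case True
      then have "3 dvd n - x\<^sup>2" using n0 by (auto simp: power2_eq_square)
      then have "3 dvd y\<^sup>2 + 2 * d\<^sup>2" unfolding xy(1) by simp
      then show ?thesis using xy(1) by blast
    next
      case False
      then have x1: "x\<^sup>2 mod 3 = 1" by (simp add: square_mod_3)
      have n0': "n mod 3 = 0" using n0 by simp
      have e: "(1 + y\<^sup>2 mod 3 + 2 * (d\<^sup>2 mod 3)) mod 3 = 0"
        using n3 unfolding n0' x1 by (rule sym)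
      \<comment> \<open>Here 3 must divide \<open>y\<close>, so 9 divides
        \<open>x^2 + 2 * d^2\<close>; dividing by 3 twice and scaling by 3 makes both entries
        multiples of 3.\<close>
      have "Y = 0" if "(1 + Y + 2 * D) mod 3 = 0" "Y = 0 \<or> Y = 1" "D = 0 \<or> D = 1" for Y D :: int
        using that by auto
      from this[OF e sq(2) sq(2)] have "y\<^sup>2 mod 3 = 0" .
      then have "3 dvd y" by (simp only: sq(1))
      then have "9 dvd y\<^sup>2" by (auto simp: power2_eq_square)
      from dvd_diff[OF n9 this] have 9: "9 dvd x\<^sup>2 + 2 * d\<^sup>2" unfolding xy(1) by simp
      have "(3 :: int) dvd 9" by simp
      from dvd_trans[OF this 9] obtain u v where uv: "x\<^sup>2 + 2 * d\<^sup>2 = 3 * (u\<^sup>2 + 2 * v\<^sup>2)"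
        using divide_by_sqrt_minus_2 by blast
      have "9 dvd 3 * W \<Longrightarrow> 3 dvd W" for W :: int by presburger
      from this[OF 9[unfolded uv]] have "3 dvd u\<^sup>2 + 2 * v\<^sup>2" .
      then obtain u' v' where uv': "u\<^sup>2 + 2 * v\<^sup>2 = 3 * (u'\<^sup>2 + 2 * v'\<^sup>2)" using divide_by_sqrt_minus_2 by blast
      have "n = (3 * u')\<^sup>2 + y\<^sup>2 + 2 * (3 * v')\<^sup>2" using xy(1) uv uv' by (simp add: power_mult_distrib)
      moreover have "3 dvd y\<^sup>2 + 2 * (3 * v')\<^sup>2"
        using \<open>3 dvd y\<close> by (intro dvd_add) (auto simp: power2_eq_square)
      ultimately show ?thesis by blast
    qed
  qed
  then obtain x d where xd: "n = x\<^sup>2 + y\<^sup>2 + 2 * d\<^sup>2" "3 dvd y\<^sup>2 + 2 * d\<^sup>2" by blast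
  obtain z where z: "y = 2 * z" using xy(2) by blast
  have e: "y\<^sup>2 + 2 * d\<^sup>2 = 2 * (d\<^sup>2 + 2 * z\<^sup>2)" using z by (simp add: power_mult_distrib)
  have "3 dvd 2 * W \<Longrightarrow> 3 dvd W" for W :: int by presburger
  from this[OF xd(2)[unfolded e]] have "3 dvd d\<^sup>2 + 2 * z\<^sup>2" .
  then obtain u v where "d\<^sup>2 + 2 * z\<^sup>2 = 3 * (u\<^sup>2 + 2 * v\<^sup>2)" using divide_by_sqrt_minus_2 by blast
  then have "n = x\<^sup>2 + 6 * u\<^sup>2 + 12 * v\<^sup>2" using xd(1) e by simp
  then show ?thesis by blast
qed

section \<open>The weights 1, 1, 2, 3, 5\<close>

text \<open>\<open>A\<close> is the weighted sum of \<open>x * (x - 1) / 2\<close>, so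
  \<open>A\<close> and \<open>B\<close> are the coefficients of \<open>m - 2\<close> and 1 in the
  polygonal form.\<close>

definition fib5 :: "int \<Rightarrow> int \<Rightarrow> bool" where
  "fib5 A B \<longleftrightarrow> (\<exists>x1 x2 x3 x4 x5. x1 + x2 + 2 * x3 + 3 * x4 + 5 * x5 = B
     \<and> x1\<^sup>2 + x2\<^sup>2 + 2 * x3\<^sup>2 + 3 * x4\<^sup>2 + 5 * x5\<^sup>2 = 2 * A + B)"

text \<open>The solutions with \<open>x\<^sub>4 - x\<^sub>5 = 2 c\<close>, where \<open>c\<close> is 1 or -1.\<close>
lemma fib5_of_form:
  assumes H: "12 * (2 * A + B) - B\<^sup>2 - 90 = 2 * z\<^sup>2 + 3 * u\<^sup>2 + 6 * t\<^sup>2"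
    and z: "odd z \<longleftrightarrow> even B" and t: "odd t \<longleftrightarrow> odd B"
    and u: "odd B \<and> odd u \<or> even B \<and> 4 dvd u - B - 2"
  shows "fib5 A B"
proof -
  have "X mod 3 = Y mod 3" if "12 * k - Y - 90 = 2 * X + 3 * U + 6 * T" for k X Y U T :: int
  proof -
    have e: "X - Y = 3 * (X - 4 * k + 30 + U + 2 * T)" using that by simp
    show ?thesis unfolding mod_eq_dvd_iff e by (rule dvd_triv_left)
  qed
  \<comment> \<open>Modulo 3 the equation equates \<open>z^2\<close> and \<open>B^2\<close>, so one
    sign of \<open>z\<close> makes \<open>z' + B\<close> divisible by 3.\<close>
  from this[OF H] have "3 dvd z \<longleftrightarrow> 3 dvd B" unfolding square_mod_3 by (simp split: if_splits)
  then have "3 dvd z + B \<or> 3 dvd - z + B" by presburger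
  then obtain z' where "z' = z \<or> z' = - z" and z3: "3 dvd z' + B" by blast
  then have z': "z'\<^sup>2 = z\<^sup>2" "3 dvd z' + B" "odd z' \<longleftrightarrow> odd z" by auto
  obtain v where v: "z' + B = 3 * v" using z'(2) by blast
  have "odd (z' + B)" using z'(3) z by auto
  then have "odd v" unfolding v by simp
  \<comment> \<open>The odd \<open>v\<close> modulo 4 selects the sign \<open>c\<close>, and with it
    the section \<open>x4 - x5 = 2 * c\<close>.\<close>
  then have "4 dvd v - 3 * 1 \<or> 4 dvd v - 3 * (-1)" by presburger
  then obtain c where c: "c = 1 \<or> c = -1" "4 dvd v - 3 * c" by blast
  then obtain y where "v - 3 * c = 4 * y" by blast
  then have y: "z' = 12 * y + 9 * c - B" using v by simp
  \<comment> \<open>The part of \<open>B\<close> left to \<open>x1 + x2 + 2 * x3\<close> when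
    \<open>x5 = y\<close> and \<open>x4 = y + 2 * c\<close>. Below, \<open>w\<close> becomes
    \<open>x3\<close>, \<open>u'\<close> is \<open>4 * x3 - b\<close>, and \<open>t\<close> is
    \<open>x1 - x2\<close>.\<close>
  define b where "b = B - 8 * y - 6 * c"
  have "4 dvd u + b \<or> 4 dvd - u + b"
  proof (cases "odd B")
    case True
    then have "odd b" "odd u" using u by (auto simp: b_def)
    then show ?thesis by presburger
  next
    case False
    then obtain C where C: "B = 2 * C" by blast
    obtain e where "u - B - 2 = 4 * e" using u False by blast
    then have "u + b = 4 * (e + C - 2 * y) + (2 - 6 * c)" by (simp add: b_def C)
    moreover have "4 dvd 2 - 6 * c" using c(1) by auto
    ultimately show ?thesis by simp
  qed
  then obtain u' where "u' = u \<or> u' = - u" and u4: "4 dvd u' + b" by blast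
  then have u': "u'\<^sup>2 = u\<^sup>2" by auto
  obtain w where "u' + b = 4 * w" using u4 by blast
  then have w: "u' = 4 * w - b" by simp
  have "even (b - 2 * w + t)" using t by (auto simp: b_def)
  then obtain v where "b - 2 * w + t = 2 * v" by blast
  then have v: "t = 2 * v - (b - 2 * w)" by simp
  have H': "12 * (2 * A + B) = B\<^sup>2 + 90 + 2 * z'\<^sup>2 + 3 * u'\<^sup>2 + 6 * t\<^sup>2" using H z'(1) u' by simp
  have c2: "c * c = 1" using c(1) by auto
  have "12 * (v\<^sup>2 + (b - 2 * w - v)\<^sup>2 + 2 * w\<^sup>2 + 3 * (y + 2 * c)\<^sup>2 + 5 * y\<^sup>2)
      = B\<^sup>2 + 90 * (c * c) + 2 * z'\<^sup>2 + 3 * u'\<^sup>2 + 6 * t\<^sup>2"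
    unfolding y w v b_def by (simp add: power2_eq_square algebra_simps)
  then have "v\<^sup>2 + (b - 2 * w - v)\<^sup>2 + 2 * w\<^sup>2 + 3 * (y + 2 * c)\<^sup>2 + 5 * y\<^sup>2 = 2 * A + B"
    unfolding c2 using H' by simp
  moreover have "v + (b - 2 * w - v) + 2 * w + 3 * (y + 2 * c) + 5 * y = B" by (simp add: b_def)
  ultimately show ?thesis unfolding fib5_def by blast
qed

text \<open>For odd \<open>B\<close> the left side is 1 modulo 8 and not 1 modulo 3, as
  \<open>form_2_3_6\<close> requires. For even \<open>B\<close> half of it is represented by
  \<open>form_1_6_12\<close>; if 6 divides \<open>B\<close>, the second hypothesis makes that half
  divisible by 9.\<close>

lemma fib5_large:
  assumes pos: "12 * (2 * A + B) - B\<^sup>2 > 90"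
    and B: "6 dvd B \<Longrightarrow> 3 dvd A + B div 2"
  shows "fib5 A B"
proof (cases "odd B")
  case True
  define n where "n = 12 * (2 * A + B) - B\<^sup>2 - 90"
  have "n > 0" using pos by (simp add: n_def)
  obtain k where k: "B = 2 * k + 1" using True by (elim oddE)
  have "B\<^sup>2 = 1 + 8 * (B\<^sup>2 div 8)"
    using mult_div_mod_eq[of 8 "B\<^sup>2"] square_odd_mod_8[OF True] by linarith
  then have "n = 1 + 8 * (3 * A + 3 * k - B\<^sup>2 div 8 - 10)" by (simp add: n_def k)
  then have "n mod 8 = 1 mod 8" by (simp only: mod_mult_self2)
  then have n8: "n mod 8 = 1" by simp
  have "(12 * K - S - 90) mod 3 \<noteq> 1" if "S mod 3 = 0 \<or> S mod 3 = 1" for K S :: int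
    using that by presburger
  from this[of "B\<^sup>2" "2 * A + B"] have "n mod 3 \<noteq> 1" by (simp add: n_def square_mod_3)
  then obtain z u t where n: "n = 2 * z\<^sup>2 + 3 * u\<^sup>2 + 6 * t\<^sup>2"
    using form_2_3_6 n8 \<open>n > 0\<close> by blast
  have "odd n" using n8 by presburger
  then have "odd u" unfolding n by simp
  have sq: "x\<^sup>2 mod 8 = 0 \<or> x\<^sup>2 mod 8 = 1 \<or> x\<^sup>2 mod 8 = 4" for x :: int
    using square_odd_mod_8 square_even_mod_8 by blast
  \<comment> \<open>For odd \<open>u\<close> the equation leaves \<open>Z + 3 * T\<close> congruent
    to 3 modulo 4, so \<open>z\<close> is even and \<open>t\<close> odd.\<close>
  have "Z mod 8 \<noteq> 1 \<and> T mod 8 = 1"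
    if "n = 2 * Z + 3 * U + 6 * T" "U mod 8 = 1" "Z mod 8 = 0 \<or> Z mod 8 = 1 \<or> Z mod 8 = 4"
      "T mod 8 = 0 \<or> T mod 8 = 1 \<or> T mod 8 = 4" for Z U T
  proof -
    have "(2 * (Z mod 8) + 3 * (U mod 8) + 6 * (T mod 8)) mod 8 = 1"
      using n8 mod_linear[of 2 Z 3 U 6 T 8] unfolding that(1) by (simp only:)
    then show ?thesis using that(2-4) by (elim disjE) simp_all
  qed
  from this[OF n square_odd_mod_8[OF \<open>odd u\<close>] sq sq] have "even z" "odd t"
    using square_odd_mod_8[of z] square_even_mod_8[of t] by auto
  then show ?thesis
    using n True \<open>odd u\<close> by (intro fib5_of_form[of A B z u t]) (auto simp: n_def)
next
  case False
  then obtain C where C: "B = 2 * C" by blast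
  define n where "n = 12 * (A + C) - 2 * C\<^sup>2 - 45"
  have n2: "12 * (2 * A + B) - B\<^sup>2 - 90 = 2 * n" by (simp add: n_def C power_mult_distrib)
  then have "n > 0" using pos by linarith
  have "odd n" by (simp add: n_def)
  have "n mod 3 = 1 \<or> 9 dvd n"
  proof (cases "3 dvd C")
    case True
    then have "6 dvd B" unfolding C by presburger
    then have "3 dvd A + C" using B by (simp add: C)
    then obtain a where "A + C = 3 * a" by blast
    moreover obtain c where "C = 3 * c" using True by blast
    ultimately have "n = 9 * (4 * a - 2 * c\<^sup>2 - 5)" by (simp add: n_def power_mult_distrib)
    then show ?thesis by simp
  next
    case False
    then have C3: "C\<^sup>2 mod 3 = 1" by (simp add: square_mod_3)
    have "(12 * k - 2 * S - 45) mod 3 = 1" if "S mod 3 = 1" for k S :: int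
      using that by presburger
    from this[OF C3, of "A + C"] show ?thesis by (simp only: n_def simp_thms)
  qed
  then obtain x y s where n: "n = x\<^sup>2 + 6 * y\<^sup>2 + 12 * s\<^sup>2"
    using form_1_6_12 \<open>n > 0\<close> \<open>odd n\<close> by blast
  then have "odd x" using \<open>odd n\<close> by auto
  \<comment> \<open>Modulo 4 the equation says that \<open>y\<close> and \<open>C\<close> have
    opposite parity, which is the condition on \<open>u = 2 * y\<close> in
    \<open>fib5_of_form\<close>.\<close>
  have "odd (Y + D)" if "X mod 8 = 1" "12 * k - 2 * D - 45 = X + 6 * Y + 12 * S" for X Y S D k :: int
  proof -
    define q where "q = X div 8"
    have "X = 8 * q + 1" using that(1) mult_div_mod_eq[of 8 X] by (simp add: q_def)
    then have e: "Y + D = 2 * (3 * k - 2 * q - Y - 3 * S - 12) + 1" using that(2) by presburger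
    show ?thesis unfolding e by simp
  qed
  from this[OF square_odd_mod_8[OF \<open>odd x\<close>] n[unfolded n_def]] have "odd (y + C)" by simp
  then have "4 dvd 2 * y - B - 2" unfolding C by presburger
  then show ?thesis
    using n n2 \<open>odd x\<close> False
    by (intro fib5_of_form[of A B x "2 * y" "2 * s"]) (auto simp: power_mult_distrib)
qed

section \<open>Fibonacci weights of arbitrary length\<close>

definition fib_sol :: "nat \<Rightarrow> int \<Rightarrow> int \<Rightarrow> bool" where
  "fib_sol n A B \<longleftrightarrow> (\<exists>x :: nat \<Rightarrow> int.
     (\<Sum>k=1..n. int (fib k) * x k) = B \<and> (\<Sum>k=1..n. int (fib k) * (x k)\<^sup>2) = 2 * A + B)"

definition fib_total :: "nat \<Rightarrow> int" where
  "fib_total n = (\<Sum>k=1..n. int (fib k))"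

lemma fib_total_eq: "fib_total n = int (fib (n + 2)) - 1"
  by (induction n) (simp_all add: fib_total_def)

lemma fib_total_Suc: "fib_total (Suc n) = fib_total n + int (fib (Suc n))"
  by (simp add: fib_total_def)

lemma fib_Suc_le_fib_total: "int (fib (Suc n)) \<le> fib_total n + 1"
  by (simp add: fib_total_eq)

lemma fib_sol_polygonal:
  assumes "fib_sol n A B"
  shows "\<exists>x. polygonal_form m n (\<lambda>k. int (fib k)) x = (m - 2) * A + B"
proof -
  obtain x where x: "(\<Sum>k=1..n. int (fib k) * x k) = B"
    "(\<Sum>k=1..n. int (fib k) * (x k)\<^sup>2) = 2 * A + B"
    using assms by (auto simp: fib_sol_def)
  have "2 * polygonal_form m n (\<lambda>k. int (fib k)) x
      = (\<Sum>k=1..n. int (fib k) * (2 * polygonal m (x k)))"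
    by (simp add: polygonal_form_def sum_distrib_left mult.left_commute)
  also have "\<dots> = (\<Sum>k=1..n. (m - 2) * (int (fib k) * (x k)\<^sup>2) - (m - 4) * (int (fib k) * x k))"
    by (simp add: double_polygonal right_diff_distrib mult_ac)
  also have "\<dots> = (m - 2) * (2 * A + B) - (m - 4) * B"
    unfolding sum_subtractf sum_distrib_left[symmetric] x ..
  also have "\<dots> = 2 * ((m - 2) * A + B)" by (simp add: algebra_simps)
  finally show ?thesis by (intro exI[of _ x]) simp
qed

lemma fib_sol_Suc:
  assumes "fib_sol n A B"
  shows "fib_sol (Suc n) A B" and "fib_sol (Suc n) A (B + int (fib (Suc n)))"
proof -
  obtain x where x: "(\<Sum>k=1..n. int (fib k) * x k) = B"
    "(\<Sum>k=1..n. int (fib k) * (x k)\<^sup>2) = 2 * A + B"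
    using assms by (auto simp: fib_sol_def)
  have eq: "(\<Sum>k=1..Suc n. int (fib k) * ((x(Suc n := e)) k) ^ j)
      = (\<Sum>k=1..n. int (fib k) * x k ^ j) + int (fib (Suc n)) * e ^ j" for e j
  proof -
    have "(\<Sum>k=1..n. int (fib k) * ((x(Suc n := e)) k) ^ j) = (\<Sum>k=1..n. int (fib k) * x k ^ j)"
      by (intro sum.cong) auto
    then show ?thesis by simp
  qed
  show "fib_sol (Suc n) A B"
    unfolding fib_sol_def using eq[of 0 1] eq[of 0 2] x by (intro exI[of _ "x(Suc n := 0)"]) simp
  show "fib_sol (Suc n) A (B + int (fib (Suc n)))"
    unfolding fib_sol_def using eq[of 1 1] eq[of 1 2] x by (intro exI[of _ "x(Suc n := 1)"]) simp
qed

text \<open>Subset sums: each Fibonacci number is at most one more than the sum of the preceding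
  ones, so the greedy choice leaves no gaps.\<close>

lemma fib_sol_zero: "0 \<le> B \<Longrightarrow> B \<le> fib_total n \<Longrightarrow> fib_sol n 0 B"
proof (induction n arbitrary: B)
  case 0
  then show ?case by (simp add: fib_sol_def fib_total_def)
next
  case (Suc n)
  show ?case
  proof (cases "B \<le> fib_total n")
    case True
    then show ?thesis using Suc fib_sol_Suc(1) by blast
  next
    case False
    then have "fib_sol n 0 (B - int (fib (Suc n)))"
      using Suc.prems fib_Suc_le_fib_total[of n] by (intro Suc.IH) (auto simp: fib_total_Suc)
    then show ?thesis using fib_sol_Suc(2) by force
  qed
qed

lemma fib_sol_5: "fib5 A B \<Longrightarrow> fib_sol 5 A B"
proof -
  assume "fib5 A B"
  then obtain x1 x2 x3 x4 x5 where x: "x1 + x2 + 2 * x3 + 3 * x4 + 5 * x5 = B"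
    "x1\<^sup>2 + x2\<^sup>2 + 2 * x3\<^sup>2 + 3 * x4\<^sup>2 + 5 * x5\<^sup>2 = 2 * A + B" unfolding fib5_def by blast
  define x where "x = (\<lambda>k. [x1, x2, x3, x4, x5] ! (k - 1))"
  have set: "{1..5} = {1, 2, 3, 4, 5 :: nat}" by auto
  have fibs: "fib 2 = 1" "fib 3 = 2" "fib 4 = 3" "fib 5 = 5" by (simp_all add: numeral_eq_Suc)
  show ?thesis
    unfolding fib_sol_def set using x by (intro exI[of _ x]) (simp add: x_def fibs)
qed

text \<open>The substitution of \<open>1 - x\<close> for \<open>x\<close> preserves
  \<open>x^2 - x\<close> and hence \<open>A\<close>; 12 is the sum of the weights.\<close>

lemma fib5_reflect:
  assumes "fib5 A B"
  shows "fib5 A (12 - B)"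
proof -
  obtain x1 x2 x3 x4 x5 where x: "x1 + x2 + 2 * x3 + 3 * x4 + 5 * x5 = B"
    "x1\<^sup>2 + x2\<^sup>2 + 2 * x3\<^sup>2 + 3 * x4\<^sup>2 + 5 * x5\<^sup>2 = 2 * A + B"
    using assms unfolding fib5_def by blast
  have "(1 - x1) + (1 - x2) + 2 * (1 - x3) + 3 * (1 - x4) + 5 * (1 - x5) = 12 - B"
    "(1 - x1)\<^sup>2 + (1 - x2)\<^sup>2 + 2 * (1 - x3)\<^sup>2 + 3 * (1 - x4)\<^sup>2 + 5 * (1 - x5)\<^sup>2 = 2 * A + (12 - B)"
    using x by (simp_all add: power2_diff)
  then show ?thesis unfolding fib5_def by blast
qed

section \<open>Small values of \<open>A\<close> by explicit solutions\<close>

definition fib5_value :: "int \<times> int \<times> int \<times> int \<times> int \<Rightarrow> int \<times> int" where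
  "fib5_value = (\<lambda>(x1, x2, x3, x4, x5). (x1 + x2 + 2 * x3 + 3 * x4 + 5 * x5,
     x1 * x1 + x2 * x2 + 2 * (x3 * x3) + 3 * (x4 * x4) + 5 * (x5 * x5)))"

definition fib5_witnesses :: "(int \<times> int \<times> int \<times> int \<times> int) list" where
  "fib5_witnesses = [
    (0, -1, 0, 0, 0), (1, -1, 0, 0, 0), (0, -1, 1, 0, 0), (0, -1, 0, 1, 0), (1, -1, 0, 1, 0),
    (0, -1, 0, 0, 1), (0, 2, 0, 1, 0), (0, -1, 1, 0, 1), (0, 1, -1, 0, 0), (1, 1, -1, 0, 0),
    (0, 0, -1, 1, 0), (0, 1, -1, 1, 0), (0, 0, -1, 0, 1), (0, 0, 2, 0, 0), (0, 1, 2, 0, 0),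
    (0, 0, -1, 1, 1), (0, 0, 1, -1, 0), (0, 1, 1, -1, 0), (0, -2, 0, 1, 0), (0, 0, 0, 2, 0),
    (0, 2, 0, -1, 0), (1, 2, 0, -1, 0), (0, 2, 1, -1, 1), (0, 0, 1, 1, -1), (0, 0, 2, -1, 1),
    (0, 1, 2, 0, -1), (0, 2, -2, 1, 1), (0, 3, 1, 0, -1), (0, -3, 2, 0, 1), (0, 1, -1, 2, -1),
    (0, 1, -1, -1, 2), (1, 1, 2, -2, 0), (0, 0, -2, 0, 2), (0, 4, -1, 1, -1), (0, 4, 2, 1,
    -1), (0, 3, -1, -2, 1), (0, 0, 1, -2, 2), (0, 4, 2, -1, -1), (0, 5, -2, 0, 1), (0, 3, -2,
    2, -1), (0, 0, 4, 1, -1), (0, 2, 1, 2, -2), (0, -2, 2, -2, 2), (0, 0, 2, 2, -2), (0, 3, 4,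
    0, -1)]"

lemma fib5_witness:
  assumes "(B, 2 * A + B) \<in> set (map fib5_value fib5_witnesses)"
  shows "fib5 A B"
proof -
  obtain x1 x2 x3 x4 x5 where "fib5_value (x1, x2, x3, x4, x5) = (B, 2 * A + B)"
    using assms by (metis (no_types, lifting) imageE prod_cases5 list.set_map)
  then have "x1 + x2 + 2 * x3 + 3 * x4 + 5 * x5 = B"
    "x1\<^sup>2 + x2\<^sup>2 + 2 * x3\<^sup>2 + 3 * x4\<^sup>2 + 5 * x5\<^sup>2 = 2 * A + B"
    by (simp_all add: fib5_value_def power2_eq_square)
  then show ?thesis unfolding fib5_def by blast
qed

text \<open>The witnesses fill the gaps of \<open>fib5_large\<close>: for \<open>A \<le> 4\<close>
  positivity may fail or 6 may divide \<open>B\<close>; from 5 on only \<open>B = 0\<close> and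
  \<open>B = 6\<close> remain, where 3 divides \<open>A + B div 2\<close> exactly when it divides
  \<open>A\<close>.\<close>

lemma fib5_table:
  "\<forall>A\<in>set [1..4]. \<forall>B\<in>set [-1..6]. 12 * (2 * A + B) - B * B > 90 \<and> \<not> 6 dvd B \<or>
     (B, 2 * A + B) \<in> set (map fib5_value fib5_witnesses)"
  "\<forall>A\<in>set [5..21]. \<forall>B\<in>set [0, 6]. 3 dvd A \<or> (B, 2 * A + B) \<in> set (map fib5_value fib5_witnesses)"
  by code_simp+

lemma fib5_small_half:
  assumes A: "1 \<le> A" "A \<le> 21" and B: "-1 \<le> B" "B \<le> 6"
  shows "fib5 A B"
proof (cases "(B, 2 * A + B) \<in> set (map fib5_value fib5_witnesses)")
  case True
  then show ?thesis by (rule fib5_witness)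
next
  case False
  have AB: "A \<in> set [1..4] \<or> A \<in> set [5..21]" "B \<in> set [-1..6]"
    unfolding set_upto using A B by auto
  show ?thesis
  proof (rule fib5_large)
    \<comment> \<open>This settles positivity for \<open>A \<ge> 5\<close>, as
      \<open>24 * 5 - 13 > 90\<close>.\<close>
    have "B * B \<le> 12 * B + 13"
    proof -
      have "0 \<le> (B + 1) * (13 - B)" using B by (intro mult_nonneg_nonneg) auto
      then show ?thesis by (simp add: algebra_simps)
    qed
    then show "12 * (2 * A + B) - B\<^sup>2 > 90"
      using fib5_table(1) AB False unfolding power2_eq_square by fastforce
    assume "6 dvd B"
    then have "B \<in> set [0, 6]" using B by (auto elim!: dvdE)
    have "A \<in> set [5..21]" using fib5_table(1) AB False \<open>6 dvd B\<close> by blast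
    then have "3 dvd A" using fib5_table(2) False \<open>B \<in> set [0, 6]\<close> by blast
    then show "3 dvd A + B div 2" using \<open>B \<in> set [0, 6]\<close> by auto
  qed
qed

lemma fib5_small:
  assumes A: "1 \<le> A" "A \<le> 21" and B: "-1 \<le> B" "B \<le> 13"
  shows "fib5 A B"
proof (cases "B \<le> 6")
  case False
  then have "fib5 A (12 - B)" using A B by (intro fib5_small_half) auto
  then have "fib5 A (12 - (12 - B))" by (rule fib5_reflect)
  then show ?thesis by simp
qed (use A B fib5_small_half in auto)

text \<open>The range, symmetric about 6, has room for shifts of \<open>B\<close> by up to 14;
  positivity holds since \<open>24 * 21 - 364 > 90\<close>.\<close>

lemma fib5_pos:
  assumes "A > 20" "-14 \<le> B" "B \<le> 26" "6 dvd B \<Longrightarrow> 3 dvd A + B div 2"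
  shows "fib5 A B"
proof (rule fib5_large)
  have "0 \<le> (B + 14) * (26 - B)" using assms(2,3) by (intro mult_nonneg_nonneg) auto
  then have "B\<^sup>2 \<le> 12 * B + 364" by (simp add: power2_eq_square algebra_simps)
  then show "12 * (2 * A + B) - B\<^sup>2 > 90" using assms(1) by simp
qed fact

text \<open>The sixth weight 8 may be used or not. For large \<open>A\<close> one of
  \<open>B\<close> and \<open>B - 8\<close> is not a multiple of 6; for small \<open>A\<close> one
  of them lies between -1 and 13.\<close>

lemma fib_sol_6:
  assumes A: "A \<ge> 1" and B: "-1 \<le> B" "B \<le> 21"
  shows "fib_sol 6 A B"
proof -
  have fib6: "fib 6 = 8" by (simp add: numeral_eq_Suc)
  have "fib5 A B \<or> fib5 A (B - 8)"
  proof (cases "A \<le> 21")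
    case True
    then show ?thesis using A B fib5_small[of A B] fib5_small[of A "B - 8"] by linarith
  next
    case False
    have "\<not> 6 dvd B \<or> \<not> 6 dvd B - 8" by presburger
    then show ?thesis using False B fib5_pos[of A B] fib5_pos[of A "B - 8"] by fastforce
  qed
  then show ?thesis
    using fib_sol_5 fib_sol_Suc[of 5 A] fib6 by force
qed

text \<open>The greedy step of \<open>fib_sol_zero\<close> again, with one unit of slack at either
  end: the main proof needs \<open>B\<close> up to \<open>M - 1 \<le> fib_total n + 1\<close>, and
  also \<open>B = -1\<close>.\<close>

lemma fib_sol_ge_6:
  assumes "n \<ge> 6" "A \<ge> 1" "-1 \<le> B" "B \<le> fib_total n + 1"
  shows "fib_sol n A B"
  using assms
proof (induction n arbitrary: B rule: dec_induct)
  case base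
  have "fib_total 6 = 20" by (simp add: fib_total_eq numeral_eq_Suc)
  then show ?case using base fib_sol_6 by simp
next
  case (step n)
  show ?case
  proof (cases "B \<le> fib_total n + 1")
    case True
    then show ?thesis using step fib_sol_Suc(1) by blast
  next
    case False
    then have "fib_sol n A (B - int (fib (Suc n)))"
      using step.prems fib_Suc_le_fib_total[of n] by (intro step.IH) (auto simp: fib_total_Suc)
    then show ?thesis using fib_sol_Suc(2) by force
  qed
qed

text \<open>Moving \<open>k\<close> from \<open>A\<close> to \<open>B\<close> in units of
  \<open>M\<close> preserves \<open>M * A + B\<close> and is used to escape the obstruction at
  multiples of 6. The split at 21 keeps \<open>A - k\<close> above 20 for
  \<open>k \<le> 1\<close>.\<close>

lemma fib_sol_5_shift:
  assumes A: "A \<ge> 1" and M: "1 \<le> M" "M \<le> 14" and B: "0 \<le> B" "B < M"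
  shows "\<exists>k. fib_sol 5 (A - k) (B + k * M)"
proof (cases "A \<le> 21")
  case True
  then have "fib5 A B" using A M B by (intro fib5_small) auto
  then show ?thesis using fib_sol_5 by (intro exI[of _ 0]) simp
next
  case False
  have "\<exists>k. (k = -1 \<or> k = 0 \<or> k = 1) \<and> (6 dvd B + k * M \<longrightarrow> 3 dvd A - k + (B + k * M) div 2) \<and> B + k * M \<le> 26"
  proof -
    consider "\<not> 6 dvd B" | "6 dvd B" "\<not> 6 dvd M" | "6 dvd B" "6 dvd M" by blast
    then show ?thesis
    proof cases
      case 1
      then show ?thesis using B M by (intro exI[of _ 0]) simp
    next
      case 2
      then have "\<not> 6 dvd B - M" by presburger
      then show ?thesis using B M by (intro exI[of _ "-1"]) simp
    next
      case 3
      \<comment> \<open>All shifted values are multiples of 6 with half divisible by 3, so only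
        \<open>A - k\<close> modulo 3 matters.\<close>
      then obtain b c where bc: "B = 6 * b" "M = 6 * c" by blast
      have "3 dvd A \<or> 3 dvd A - 1 \<or> 3 dvd A + 1" by presburger
      then obtain k where k: "k = -1 \<or> k = 0 \<or> k = 1" "3 dvd A - k" by force
      have "(B + k * M) div 2 = 3 * (b + k * c)" unfolding bc by simp
      moreover have "B + k * M \<le> 26" using bc B M k(1) by auto
      ultimately show ?thesis using k by (intro exI[of _ k]) simp
    qed
  qed
  then obtain k where k: "k = -1 \<or> k = 0 \<or> k = 1"
    "6 dvd B + k * M \<Longrightarrow> 3 dvd A - k + (B + k * M) div 2" "B + k * M \<le> 26" by blast
  have "fib5 (A - k) (B + k * M)"
    by (rule fib5_pos) (use k False B M in auto)
  then show ?thesis using fib_sol_5 by blast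
qed

theorem theorem4p3:
  fixes m :: int and n :: nat
  assumes "m \<ge> 3"
    and "n \<ge> 5"
    and "(\<Sum>k = 1..n. int (fib k)) \<ge> m - 4"
  shows "universal_polygonal_form m n (\<lambda>k. int (fib k))"
  unfolding universal_polygonal_form_def
proof (intro allI impI)
  fix N :: int assume "N > 0"
  define M where "M = m - 2"
  have M: "M \<ge> 1" "M \<le> fib_total n + 2" using assms by (auto simp: M_def fib_total_def)
  define A where "A = N div M"
  define B where "B = N mod M"
  have N: "N = M * A + B" by (simp add: A_def B_def)
  have B: "0 \<le> B" "B < M" using M by (auto simp: B_def)
  have A: "A \<ge> 0" using M \<open>N > 0\<close> by (simp add: A_def pos_imp_zdiv_nonneg_iff)
  have "\<exists>A B. fib_sol n A B \<and> N = M * A + B"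
  proof (cases "A = 0")
    case True
    show ?thesis
    proof (cases "B \<le> fib_total n")
      case True
      then show ?thesis using \<open>A = 0\<close> N B fib_sol_zero by blast
    next
      case False
      \<comment> \<open>Only \<open>N = M - 1 = fib_total n + 1\<close> is left, beyond the reach of
        \<open>A = 0\<close>; it is written with \<open>A = 1\<close> and
        \<open>B = -1\<close>.\<close>
      then have "N = M * 1 + (-1)" using \<open>A = 0\<close> N B M by simp
      moreover have "fib_sol n 1 (-1)"
      proof (cases "n = 5")
        case True
        then show ?thesis using fib_sol_5 fib5_small[of 1 "-1"] by simp
      next
        case False
        have "0 \<le> fib_total n" by (simp add: fib_total_def sum_nonneg)
        then show ?thesis using False \<open>n \<ge> 5\<close> by (intro fib_sol_ge_6) auto
      qed
      ultimately show ?thesis by blast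
    qed
  next
    case False
    then have A1: "A \<ge> 1" using A by simp
    show ?thesis
    proof (cases "n = 5")
      case True
      have "fib_total 5 = 12" by (simp add: fib_total_eq numeral_eq_Suc)
      then obtain k where "fib_sol n (A - k) (B + k * M)"
        using fib_sol_5_shift[OF A1 M(1) _ B] M(2) True by auto
      moreover have "N = M * (A - k) + (B + k * M)" unfolding N by (simp add: algebra_simps)
      ultimately show ?thesis by blast
    next
      case False
      then have "fib_sol n A B" using A1 B M \<open>n \<ge> 5\<close> by (intro fib_sol_ge_6) auto
      then show ?thesis using N by blast
    qed
  qed
  then show "\<exists>x. polygonal_form m n (\<lambda>k. int (fib k)) x = N"
    using fib_sol_polygonal unfolding M_def by metis
qed

end
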